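(* Let $S$ be an (additively written) abelian group, let $S^0=\{\alpha\in S\mid 2\alpha=0\}$, and set $$I=\mathrm{span}\{d^{\alpha+\gamma,\beta+\gamma}-d^{\alpha,\beta}\mid\alpha,\beta\in S,\ \gamma\in S^0\}\subset\mathfrak{g}_S.$$ Then $I$ is an ideal of $\mathfrak{g}_S$. Furthermore, the quotient Lie algebra $\mathfrak{g}_S/I$ is isomorphic to $\mathcal{A}_S^\tau$.
   Context: All algebras are over $\mathbb{C}$. $\mathfrak{g}_S$ is the Lie algebra with generators $d^{\alpha,\beta}$ ($\alpha,\beta\in S$), subject to $d^{-\alpha,\beta}=-d^{\alpha,\beta}$ and $$[d^{\alpha,\beta},d^{\mu,\nu}]=\delta_{\alpha+\mu,\nu-\beta}d^{\alpha+\mu,-\alpha+\nu}-\delta_{\alpha+\mu,\beta-\nu}d^{\alpha+\mu,\alpha+\nu}-\delta_{\alpha-\mu,\nu-\beta}d^{\alpha-\mu,\nu-\alpha}+\delta_{\alpha-\mu,\beta-\nu}d^{\alpha-\mu,\alpha+\nu}.$$ $\mathfrak{gl}_S$ is the associative algebra with basis $E_{\alpha,\beta}$ ($\alpha,\beta\in S$) and product $E_{\alpha,\beta}\cdot E_{\mu,\nu}=\delta_{\beta,\mu}E_{\alpha,\nu}$, viewed also as a Lie algebra under the commutator. $\tau$ is the Lie algebra automorphism of $\mathfrak{gl}_S$ with $\tau(E_{\alpha,\beta})=-E_{\beta,\alpha}$. $\mathcal{A}_S=\mathrm{span}\{E_{\alpha+\beta,\beta-\alpha}\mid\alpha,\beta\in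 S\}$ is a $\tau$-stable associative subalgebra of $\mathfrak{gl}_S$, and $\mathcal{A}_S^\tau=\{a\in\mathcal{A}_S\mid\tau(a)=a\}$, a Lie subalgebra. *)

theory Defs
  imports
    "HOL-Algebra.QuotRing"
    "HOL-Algebra.Algebraic_Closure_Type"
    "HOL-Library.Poly_Mapping"
    "HOL.Hull"
begin

section \<open>Complex algebras and Lie algebras\<close>

text \<open>
  Algebras (not necessarily associative, not necessarily unital) are elements of the record type
  \<open>(complex, 'v) module\<close>; the \<^const>\<open>monoid.mult\<close> field, written \<open>\<otimes>\<close>, is the product of the algebra.
  For a Lie algebra \<open>x \<otimes>\<^bsub>L\<^esub> y\<close> is the bracket \<open>[x, y]\<close>.  The \<^const>\<open>monoid.one\<close> field plays no role.
\<close>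

abbreviation complex_ring :: "complex ring" where
  "complex_ring \<equiv> ring_of_type_algebra"

locale complex_algebra = module complex_ring A for A (structure) +
  assumes prod_closed: "\<lbrakk>x \<in> carrier A; y \<in> carrier A\<rbrakk> \<Longrightarrow> x \<otimes>\<^bsub>A\<^esub> y \<in> carrier A"
    and prod_add_left: "\<lbrakk>x \<in> carrier A; y \<in> carrier A; z \<in> carrier A\<rbrakk> \<Longrightarrow>
      (x \<oplus>\<^bsub>A\<^esub> y) \<otimes>\<^bsub>A\<^esub> z = (x \<otimes>\<^bsub>A\<^esub> z) \<oplus>\<^bsub>A\<^esub> (y \<otimes>\<^bsub>A\<^esub> z)"
    and prod_add_right: "\<lbrakk>x \<in> carrier A; y \<in> carrier A; z \<in> carrier A\<rbrakk> \<Longrightarrow>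
      x \<otimes>\<^bsub>A\<^esub> (y \<oplus>\<^bsub>A\<^esub> z) = (x \<otimes>\<^bsub>A\<^esub> y) \<oplus>\<^bsub>A\<^esub> (x \<otimes>\<^bsub>A\<^esub> z)"
    and prod_smult_left: "\<lbrakk>x \<in> carrier A; y \<in> carrier A\<rbrakk> \<Longrightarrow>
      (c \<odot>\<^bsub>A\<^esub> x) \<otimes>\<^bsub>A\<^esub> y = c \<odot>\<^bsub>A\<^esub> (x \<otimes>\<^bsub>A\<^esub> y)"
    and prod_smult_right: "\<lbrakk>x \<in> carrier A; y \<in> carrier A\<rbrakk> \<Longrightarrow>
      x \<otimes>\<^bsub>A\<^esub> (c \<odot>\<^bsub>A\<^esub> y) = c \<odot>\<^bsub>A\<^esub> (x \<otimes>\<^bsub>A\<^esub> y)"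

locale lie_algebra = complex_algebra L for L (structure) +
  assumes alternating: "x \<in> carrier L \<Longrightarrow> x \<otimes>\<^bsub>L\<^esub> x = \<zero>\<^bsub>L\<^esub>"
    and jacobi: "\<lbrakk>x \<in> carrier L; y \<in> carrier L; z \<in> carrier L\<rbrakk> \<Longrightarrow>
      (x \<otimes>\<^bsub>L\<^esub> (y \<otimes>\<^bsub>L\<^esub> z)) \<oplus>\<^bsub>L\<^esub> (y \<otimes>\<^bsub>L\<^esub> (z \<otimes>\<^bsub>L\<^esub> x)) \<oplus>\<^bsub>L\<^esub> (z \<otimes>\<^bsub>L\<^esub> (x \<otimes>\<^bsub>L\<^esub> y)) = \<zero>\<^bsub>L\<^esub>"

definition algebra_ideal :: "'v set \<Rightarrow> (complex, 'v) module \<Rightarrow> bool" where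
  "algebra_ideal I A \<longleftrightarrow> submodule I complex_ring A \<and>
     (\<forall>x\<in>carrier A. \<forall>y\<in>I. x \<otimes>\<^bsub>A\<^esub> y \<in> I \<and> y \<otimes>\<^bsub>A\<^esub> x \<in> I)"

definition lie_ideal :: "'v set \<Rightarrow> (complex, 'v) module \<Rightarrow> bool" where
  "lie_ideal I L \<longleftrightarrow> lie_algebra L \<and> algebra_ideal I L"

definition lin_span :: "(complex, 'v) module \<Rightarrow> 'v set \<Rightarrow> 'v set" where
  "lin_span A B = (\<lambda>H. submodule H complex_ring A) hull B"

text \<open>
  The carrier, product, addition and zero of the quotient are those of \<^const>\<open>FactRing\<close>, whose
  definition makes sense without associativity; the scalar action is defined on cosets in the same
  way as \<^const>\<open>rcoset_mult\<close>.
\<close>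

definition quotient_algebra :: "(complex, 'v) module \<Rightarrow> 'v set \<Rightarrow> (complex, 'v set) module" where
  "quotient_algebra A I =
     ring.extend (A Quot I)
       (module.fields (\<lambda>c C. \<Union>x\<in>C. I +>\<^bsub>A\<^esub> (c \<odot>\<^bsub>A\<^esub> x)))"

definition lie_iso :: "(complex, 'v) module \<Rightarrow> (complex, 'w) module \<Rightarrow> ('v \<Rightarrow> 'w) set" where
  "lie_iso L M = {f. bij_betw f (carrier L) (carrier M) \<and>
     (\<forall>x\<in>carrier L. \<forall>y\<in>carrier L. f (x \<oplus>\<^bsub>L\<^esub> y) = f x \<oplus>\<^bsub>M\<^esub> f y) \<and>
     (\<forall>c. \<forall>x\<in>carrier L. f (c \<odot>\<^bsub>L\<^esub> x) = c \<odot>\<^bsub>M\<^esub> f x) \<and>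
     (\<forall>x\<in>carrier L. \<forall>y\<in>carrier L. f (x \<otimes>\<^bsub>L\<^esub> y) = f x \<otimes>\<^bsub>M\<^esub> f y)}"

definition lie_isomorphic :: "(complex, 'v) module \<Rightarrow> (complex, 'w) module \<Rightarrow> bool" where
  "lie_isomorphic L M \<longleftrightarrow> lie_algebra L \<and> lie_algebra M \<and> lie_iso L M \<noteq> {}"

definition commutator_algebra :: "(complex, 'v) module \<Rightarrow> (complex, 'v) module" where
  "commutator_algebra A = A\<lparr>monoid.mult := (\<lambda>x y. (x \<otimes>\<^bsub>A\<^esub> y) \<ominus>\<^bsub>A\<^esub> (y \<otimes>\<^bsub>A\<^esub> x))\<rparr>"


section \<open>Vector spaces and algebras with a given basis\<close>

text \<open>
  The vector space with basis \<open>'k\<close> is \<open>'k \<Rightarrow>\<^sub>0 complex\<close>, the basis vectors being \<open>basis_vec k\<close>.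
  The multiplication that \<^theory>\<open>HOL-Library.Poly_Mapping\<close> puts on this type (convolution along
  the addition of \<open>'k\<close>) is never used.
\<close>

definition basis_vec :: "'k \<Rightarrow> ('k \<Rightarrow>\<^sub>0 complex)" where
  "basis_vec k = Poly_Mapping.single k 1"

definition scale_vec :: "complex \<Rightarrow> ('k \<Rightarrow>\<^sub>0 complex) \<Rightarrow> ('k \<Rightarrow>\<^sub>0 complex)" where
  "scale_vec c x = Poly_Mapping.map ((*) c) x"

definition linear_extension ::
  "('i \<Rightarrow> ('k \<Rightarrow>\<^sub>0 complex)) \<Rightarrow> ('i \<Rightarrow>\<^sub>0 complex) \<Rightarrow> ('k \<Rightarrow>\<^sub>0 complex)" where
  "linear_extension f x =
     (\<Sum>i\<in>Poly_Mapping.keys x. scale_vec (Poly_Mapping.lookup x i) (f i))"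

definition bilinear_extension ::
  "('i \<Rightarrow> 'j \<Rightarrow> ('k \<Rightarrow>\<^sub>0 complex)) \<Rightarrow> ('i \<Rightarrow>\<^sub>0 complex) \<Rightarrow> ('j \<Rightarrow>\<^sub>0 complex) \<Rightarrow> ('k \<Rightarrow>\<^sub>0 complex)" where
  "bilinear_extension f x y =
     (\<Sum>i\<in>Poly_Mapping.keys x. \<Sum>j\<in>Poly_Mapping.keys y.
        scale_vec (Poly_Mapping.lookup x i * Poly_Mapping.lookup y j) (f i j))"

definition algebra_on_basis ::
  "('k \<Rightarrow> 'k \<Rightarrow> ('k \<Rightarrow>\<^sub>0 complex)) \<Rightarrow> (complex, 'k \<Rightarrow>\<^sub>0 complex) module" where
  "algebra_on_basis m =
     \<lparr>carrier = UNIV, monoid.mult = bilinear_extension m, monoid.one = undefined,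
      zero = 0, add = (+), module.smult = scale_vec\<rparr>"


section \<open>Lie algebras given by generators and relations\<close>

datatype 'x magma = Gen 'x | Br "'x magma" "'x magma"

definition free_algebra :: "(complex, 'x magma \<Rightarrow>\<^sub>0 complex) module" where
  "free_algebra = algebra_on_basis (\<lambda>u v. basis_vec (Br u v))"

definition free_gen :: "'x \<Rightarrow> ('x magma \<Rightarrow>\<^sub>0 complex)" where
  "free_gen x = basis_vec (Gen x)"

abbreviation free_bracket ::
  "('x magma \<Rightarrow>\<^sub>0 complex) \<Rightarrow> ('x magma \<Rightarrow>\<^sub>0 complex) \<Rightarrow> ('x magma \<Rightarrow>\<^sub>0 complex)" where
  "free_bracket x y \<equiv> x \<otimes>\<^bsub>free_algebra\<^esub> y"

definition lie_axiom_elements :: "('x magma \<Rightarrow>\<^sub>0 complex) set" where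
  "lie_axiom_elements =
     {free_bracket x x | x. True} \<union>
     {free_bracket x (free_bracket y z) + free_bracket y (free_bracket z x)
        + free_bracket z (free_bracket x y) | x y z. True}"

text \<open>
  The Lie algebra with generators \<open>'x\<close> and relators \<open>R\<close> (each relator is set to zero) is the free
  nonassociative algebra on \<open>'x\<close> modulo the two-sided ideal generated by the Lie algebra axioms
  and by \<open>R\<close>; for \<open>R = {}\<close> this is the free Lie algebra on \<open>'x\<close>.
\<close>

definition relation_ideal :: "('x magma \<Rightarrow>\<^sub>0 complex) set \<Rightarrow> ('x magma \<Rightarrow>\<^sub>0 complex) set" where
  "relation_ideal R = (\<lambda>K. algebra_ideal K free_algebra) hull (lie_axiom_elements \<union> R)"

definition presented_lie_algebra ::
  "('x magma \<Rightarrow>\<^sub>0 complex) set \<Rightarrow> (complex, ('x magma \<Rightarrow>\<^sub>0 complex) set) module" where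
  "presented_lie_algebra R = quotient_algebra free_algebra (relation_ideal R)"

definition presented_gen ::
  "('x magma \<Rightarrow>\<^sub>0 complex) set \<Rightarrow> 'x \<Rightarrow> ('x magma \<Rightarrow>\<^sub>0 complex) set" where
  "presented_gen R x = relation_ideal R +>\<^bsub>free_algebra\<^esub> free_gen x"


section \<open>The Lie algebra attached to an abelian group\<close>

text \<open>
  The abelian group is the type \<open>'a\<close>, passed to the constants below as \<open>S :: 'a itself\<close>.
  A term \<open>\<delta>\<^bsub>x,y\<^esub> v\<close> is written \<open>v when x = y\<close>.
\<close>

type_synonym 'a gS_free = "('a \<times> 'a) magma \<Rightarrow>\<^sub>0 complex"

definition gS_relators :: "'a::ab_group_add itself \<Rightarrow> 'a gS_free set" where
  "gS_relators S =
    (let d = (\<lambda>\<alpha> \<beta>. free_gen (\<alpha>, \<beta>)) in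
     {d (- \<alpha>) \<beta> - (- d \<alpha> \<beta>) | \<alpha> \<beta>. True} \<union>
     {free_bracket (d \<alpha> \<beta>) (d \<mu> \<nu>)
       - ((d (\<alpha> + \<mu>) (- \<alpha> + \<nu>) when \<alpha> + \<mu> = \<nu> - \<beta>)
        - (d (\<alpha> + \<mu>) (\<alpha> + \<nu>) when \<alpha> + \<mu> = \<beta> - \<nu>)
        - (d (\<alpha> - \<mu>) (\<nu> - \<alpha>) when \<alpha> - \<mu> = \<nu> - \<beta>)
        + (d (\<alpha> - \<mu>) (\<alpha> + \<nu>) when \<alpha> - \<mu> = \<beta> - \<nu>)) | \<alpha> \<beta> \<mu> \<nu>. True})"

definition gS :: "'a::ab_group_add itself \<Rightarrow> (complex, 'a gS_free set) module" where
  "gS S = presented_lie_algebra (gS_relators S)"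

definition gS_d :: "'a::ab_group_add \<Rightarrow> 'a \<Rightarrow> 'a gS_free set" where
  "gS_d \<alpha> \<beta> = presented_gen (gS_relators TYPE('a)) (\<alpha>, \<beta>)"


section \<open>Finitary matrices indexed by the group\<close>

type_synonym 'a glS = "('a \<times> 'a) \<Rightarrow>\<^sub>0 complex"

definition glS_E :: "'a \<Rightarrow> 'a \<Rightarrow> 'a glS" where
  "glS_E \<alpha> \<beta> = basis_vec (\<alpha>, \<beta>)"

definition glS :: "'a itself \<Rightarrow> (complex, 'a glS) module" where
  "glS S = algebra_on_basis (\<lambda>(\<alpha>, \<beta>) (\<mu>, \<nu>). (glS_E \<alpha> \<nu> when \<beta> = \<mu>))"

definition glS_tau :: "'a glS \<Rightarrow> 'a glS" where
  "glS_tau = linear_extension (\<lambda>(\<alpha>, \<beta>). - glS_E \<beta> \<alpha>)"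

definition AS :: "'a::ab_group_add itself \<Rightarrow> 'a glS set" where
  "AS S = lin_span (glS S) {glS_E (\<alpha> + \<beta>) (\<beta> - \<alpha>) | \<alpha> \<beta>. True}"

definition AS_tau :: "'a::ab_group_add itself \<Rightarrow> (complex, 'a glS) module" where
  "AS_tau S = (commutator_algebra (glS S))\<lparr>carrier := {a \<in> AS S. glS_tau a = a}\<rparr>"

end

theory Submission
  imports Defs
begin

text \<open>
  The matrices \<open>D(\<alpha>, \<beta>) = E\<^bsub>\<beta>-\<alpha>,\<alpha>+\<beta>\<^esub> - E\<^bsub>\<alpha>+\<beta>,\<beta>-\<alpha>\<^esub>\<close> satisfy the defining relations of \<open>\<gg>\<^sub>S\<close>,
  so \<open>d\<^bsup>\<alpha>,\<beta>\<^esup> \<mapsto> D(\<alpha>, \<beta>)\<close> extends to a homomorphism \<open>\<phi>\<close> into the \<open>\<tau>\<close>-fixed matrices.  It kills the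
  spanning set of \<open>I\<close>, as \<open>(\<alpha> + \<beta>, \<beta> - \<alpha>)\<close> determines \<open>(\<alpha>, \<beta>)\<close> exactly up to a diagonal shift by
  \<open>\<gamma>\<close> with \<open>2\<gamma> = 0\<close>.  Choosing a preimage of each pair gives a linear map
  \<open>E\<^bsub>\<alpha>+\<beta>,\<beta>-\<alpha>\<^esub> \<mapsto> - d\<^bsup>\<alpha>,\<beta>\<^esup> / 2\<close> which is a right inverse of \<open>\<phi>\<close> on \<open>\<tau>\<close>-fixed matrices and, because the
  generators span \<open>\<gg>\<^sub>S\<close>, a left inverse modulo \<open>I\<close>.  Hence \<open>\<phi>\<close> is onto with kernel \<open>I\<close>, and in
  particular \<open>I\<close> is an ideal.
\<close>

section \<open>Homomorphisms and quotients of algebras\<close>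

lemma complex_ring_simps [simp]:
  "carrier complex_ring = UNIV"
  "a \<otimes>\<^bsub>complex_ring\<^esub> b = a * b"
  "a \<oplus>\<^bsub>complex_ring\<^esub> b = a + b"
  "\<one>\<^bsub>complex_ring\<^esub> = 1"
  "\<zero>\<^bsub>complex_ring\<^esub> = 0"
  by (simp_all add: ring_of_type_algebra_def)

text \<open>Preservation of zero is a separate clause because the target is a bare record:
  homomorphisms serve to prove that their target is an algebra, before it is known to be a
  group.\<close>

definition alg_hom ::
  "(complex, 'v, 'm) module_scheme \<Rightarrow> (complex, 'w, 'n) module_scheme \<Rightarrow> ('v \<Rightarrow> 'w) \<Rightarrow> bool" where
  "alg_hom A B f \<longleftrightarrow>
     (\<forall>x\<in>carrier A. f x \<in> carrier B) \<and> f \<zero>\<^bsub>A\<^esub> = \<zero>\<^bsub>B\<^esub> \<and>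
     (\<forall>x\<in>carrier A. \<forall>y\<in>carrier A. f (x \<oplus>\<^bsub>A\<^esub> y) = f x \<oplus>\<^bsub>B\<^esub> f y) \<and>
     (\<forall>c. \<forall>x\<in>carrier A. f (c \<odot>\<^bsub>A\<^esub> x) = c \<odot>\<^bsub>B\<^esub> f x) \<and>
     (\<forall>x\<in>carrier A. \<forall>y\<in>carrier A. f (x \<otimes>\<^bsub>A\<^esub> y) = f x \<otimes>\<^bsub>B\<^esub> f y)"

lemma alg_homD:
  assumes "alg_hom A B f"
  shows "x \<in> carrier A \<Longrightarrow> f x \<in> carrier B"
    and "f \<zero>\<^bsub>A\<^esub> = \<zero>\<^bsub>B\<^esub>"
    and "\<lbrakk>x \<in> carrier A; y \<in> carrier A\<rbrakk> \<Longrightarrow> f (x \<oplus>\<^bsub>A\<^esub> y) = f x \<oplus>\<^bsub>B\<^esub> f y"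
    and "x \<in> carrier A \<Longrightarrow> f (c \<odot>\<^bsub>A\<^esub> x) = c \<odot>\<^bsub>B\<^esub> f x"
    and "\<lbrakk>x \<in> carrier A; y \<in> carrier A\<rbrakk> \<Longrightarrow> f (x \<otimes>\<^bsub>A\<^esub> y) = f x \<otimes>\<^bsub>B\<^esub> f y"
  using assms unfolding alg_hom_def by auto

context complex_algebra
begin

lemma prod_smult_closed [simp]:
  "x \<in> carrier A \<Longrightarrow> y \<in> carrier A \<Longrightarrow> x \<otimes>\<^bsub>A\<^esub> y \<in> carrier A"
  "x \<in> carrier A \<Longrightarrow> c \<odot>\<^bsub>A\<^esub> x \<in> carrier A"
  by (simp_all add: prod_closed)

lemma prod_zero_left [simp]: "x \<in> carrier A \<Longrightarrow> \<zero>\<^bsub>A\<^esub> \<otimes>\<^bsub>A\<^esub> x = \<zero>\<^bsub>A\<^esub>"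
  using prod_smult_left[of "\<zero>\<^bsub>A\<^esub>" x 0] smult_l_null by simp

lemma prod_zero_right [simp]: "x \<in> carrier A \<Longrightarrow> x \<otimes>\<^bsub>A\<^esub> \<zero>\<^bsub>A\<^esub> = \<zero>\<^bsub>A\<^esub>"
  using prod_smult_right[of x "\<zero>\<^bsub>A\<^esub>" 0] smult_l_null by simp

text \<open>All elements of \<open>B\<close> have preimages, so each axiom of \<open>B\<close> is
  the image under \<open>f\<close> of the same axiom of \<open>A\<close>. Applied to the coset map,
  this makes quotients into algebras.\<close>

lemma complex_algebra_hom_image:
  assumes f: "alg_hom A B f" and surj: "f ` carrier A = carrier B"
  shows "complex_algebra B"
proof -
  note h = alg_homD[OF f]
  have onto: "\<exists>a\<in>carrier A. x = f a" if "x \<in> carrier B" for x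
    using that surj by blast
  have "abelian_group B"
  proof (rule abelian_groupI)
    show "\<zero>\<^bsub>B\<^esub> \<in> carrier B" using h(1)[of "\<zero>\<^bsub>A\<^esub>"] h(2) by simp
  next
    fix x y assume "x \<in> carrier B" "y \<in> carrier B"
    then obtain a b where "a \<in> carrier A" "x = f a" "b \<in> carrier A" "y = f b"
      using onto by metis
    then show "x \<oplus>\<^bsub>B\<^esub> y \<in> carrier B" "x \<oplus>\<^bsub>B\<^esub> y = y \<oplus>\<^bsub>B\<^esub> x"
      using h(1)[of "a \<oplus>\<^bsub>A\<^esub> b"] by (simp_all add: h(3)[symmetric] M.a_comm)
  next
    fix x y z assume "x \<in> carrier B" "y \<in> carrier B" "z \<in> carrier B"
    then obtain a b c where "a \<in> carrier A" "x = f a" "b \<in> carrier A" "y = f b"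
      "c \<in> carrier A" "z = f c"
      using onto by metis
    then show "x \<oplus>\<^bsub>B\<^esub> y \<oplus>\<^bsub>B\<^esub> z = x \<oplus>\<^bsub>B\<^esub> (y \<oplus>\<^bsub>B\<^esub> z)"
      by (simp add: h(3)[symmetric] M.a_assoc)
  next
    fix x assume "x \<in> carrier B"
    then obtain a where a: "a \<in> carrier A" "x = f a"
      using onto by metis
    then show "\<zero>\<^bsub>B\<^esub> \<oplus>\<^bsub>B\<^esub> x = x"
      by (simp add: h(2,3)[symmetric])
    have "f (\<ominus>\<^bsub>A\<^esub> a) \<oplus>\<^bsub>B\<^esub> x = \<zero>\<^bsub>B\<^esub>"
      using a by (simp add: h(2,3)[symmetric] M.l_neg)
    then show "\<exists>y\<in>carrier B. y \<oplus>\<^bsub>B\<^esub> x = \<zero>\<^bsub>B\<^esub>"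
      using a h(1) by blast
  qed
  then have "module complex_ring B"
  proof (intro moduleI cring_from_type_algebra, goal_cases)
    case (2 c x)
    then obtain a where "a \<in> carrier A" "x = f a"
      using onto by metis
    then show ?case using h(1)[of "c \<odot>\<^bsub>A\<^esub> a"] by (simp add: h(4))
  next
    case (3 c d x)
    then obtain a where "a \<in> carrier A" "x = f a"
      using onto by metis
    then show ?case using smult_l_distr[of c d a] by (simp add: h(3,4)[symmetric])
  next
    case (4 c x y)
    then obtain a b where "a \<in> carrier A" "x = f a" "b \<in> carrier A" "y = f b"
      using onto by metis
    then show ?case using smult_r_distr[of c a b] by (simp add: h(3,4)[symmetric])
  next
    case (5 c d x)
    then obtain a where "a \<in> carrier A" "x = f a"
      using onto by metis
    then show ?case using smult_assoc1[of c d a] by (simp add: h(4)[symmetric])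
  next
    case (6 x)
    then obtain a where "a \<in> carrier A" "x = f a"
      using onto by metis
    then show ?case using smult_one[of a] by (simp add: h(4)[symmetric])
  qed
  moreover have "complex_algebra_axioms B"
  proof (rule complex_algebra_axioms.intro)
    fix x y c assume "x \<in> carrier B" "y \<in> carrier B"
    then obtain a b where "a \<in> carrier A" "x = f a" "b \<in> carrier A" "y = f b"
      using onto by metis
    then show "x \<otimes>\<^bsub>B\<^esub> y \<in> carrier B"
      "c \<odot>\<^bsub>B\<^esub> x \<otimes>\<^bsub>B\<^esub> y = c \<odot>\<^bsub>B\<^esub> (x \<otimes>\<^bsub>B\<^esub> y)"
      "x \<otimes>\<^bsub>B\<^esub> (c \<odot>\<^bsub>B\<^esub> y) = c \<odot>\<^bsub>B\<^esub> (x \<otimes>\<^bsub>B\<^esub> y)"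
      using h(1)[of "a \<otimes>\<^bsub>A\<^esub> b"]
      by (simp_all add: h(4,5)[symmetric] prod_smult_left prod_smult_right)
  next
    fix x y z assume "x \<in> carrier B" "y \<in> carrier B" "z \<in> carrier B"
    then obtain a b c where "a \<in> carrier A" "x = f a" "b \<in> carrier A" "y = f b"
      "c \<in> carrier A" "z = f c"
      using onto by metis
    then show "(x \<oplus>\<^bsub>B\<^esub> y) \<otimes>\<^bsub>B\<^esub> z = x \<otimes>\<^bsub>B\<^esub> z \<oplus>\<^bsub>B\<^esub> y \<otimes>\<^bsub>B\<^esub> z"
      "x \<otimes>\<^bsub>B\<^esub> (y \<oplus>\<^bsub>B\<^esub> z) = x \<otimes>\<^bsub>B\<^esub> y \<oplus>\<^bsub>B\<^esub> x \<otimes>\<^bsub>B\<^esub> z"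
      by (simp_all add: h(3,5)[symmetric] prod_add_left prod_add_right)
  qed
  ultimately show ?thesis by (rule complex_algebra.intro)
qed

lemma hom_diff:
  assumes f: "alg_hom A B f" and B: "complex_algebra B" and "x \<in> carrier A" "y \<in> carrier A"
  shows "f (x \<ominus>\<^bsub>A\<^esub> y) = f x \<ominus>\<^bsub>B\<^esub> f y"
proof -
  note h = alg_homD[OF f]
  interpret B: complex_algebra B by fact
  have "f (\<ominus>\<^bsub>A\<^esub> y) \<oplus>\<^bsub>B\<^esub> f y = \<zero>\<^bsub>B\<^esub>"
    using assms by (simp add: h(2,3)[symmetric] M.l_neg)
  then have "f (\<ominus>\<^bsub>A\<^esub> y) = \<ominus>\<^bsub>B\<^esub> f y"
    using assms h(1) by (intro B.M.minus_equality[symmetric]) auto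
  then show ?thesis
    using assms by (simp add: a_minus_def h(3))
qed

lemma submodule_closed:
  assumes "submodule H complex_ring A"
  shows "H \<subseteq> carrier A" "\<zero>\<^bsub>A\<^esub> \<in> H" "x \<in> H \<Longrightarrow> y \<in> H \<Longrightarrow> x \<oplus>\<^bsub>A\<^esub> y \<in> H"
    "x \<in> H \<Longrightarrow> c \<odot>\<^bsub>A\<^esub> x \<in> H" "x \<in> H \<Longrightarrow> y \<in> H \<Longrightarrow> x \<ominus>\<^bsub>A\<^esub> y \<in> H"
proof -
  interpret submodule H complex_ring A by fact
  show "H \<subseteq> carrier A" "\<zero>\<^bsub>A\<^esub> \<in> H" using subset one_closed by auto
  show "x \<in> H \<Longrightarrow> y \<in> H \<Longrightarrow> x \<oplus>\<^bsub>A\<^esub> y \<in> H" "x \<in> H \<Longrightarrow> c \<odot>\<^bsub>A\<^esub> x \<in> H"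
    using m_closed smult_closed by auto
  show "x \<in> H \<Longrightarrow> y \<in> H \<Longrightarrow> x \<ominus>\<^bsub>A\<^esub> y \<in> H"
    using submoduleE(3,5)[OF assms] by (simp add: a_minus_def)
qed

text \<open>Closure under negation comes from closure under scalars, since \<open>-1\<close> times
  \<open>x\<close> is the additive inverse of \<open>x\<close>.\<close>

lemma complex_submoduleI:
  assumes "H \<subseteq> carrier A" "\<zero>\<^bsub>A\<^esub> \<in> H" "\<And>x y. x \<in> H \<Longrightarrow> y \<in> H \<Longrightarrow> x \<oplus>\<^bsub>A\<^esub> y \<in> H"
    "\<And>c x. x \<in> H \<Longrightarrow> c \<odot>\<^bsub>A\<^esub> x \<in> H"
  shows "submodule H complex_ring A"
proof (rule submoduleI)
  fix x assume x: "x \<in> H"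
  have "(-1) \<odot>\<^bsub>A\<^esub> x \<oplus>\<^bsub>A\<^esub> x = ((-1) \<oplus>\<^bsub>complex_ring\<^esub> 1) \<odot>\<^bsub>A\<^esub> x"
    using x assms(1) smult_one by (subst smult_l_distr) auto
  then have "(-1) \<odot>\<^bsub>A\<^esub> x \<oplus>\<^bsub>A\<^esub> x = \<zero>\<^bsub>A\<^esub>"
    using x assms(1) smult_l_null by auto
  then have "\<ominus>\<^bsub>A\<^esub> x = (-1) \<odot>\<^bsub>A\<^esub> x"
    using x assms(1) by (intro M.minus_equality) auto
  then show "\<ominus>\<^bsub>A\<^esub> x \<in> H" using assms(4) x by simp
qed (use assms in auto)

lemma submodule_Inter:
  assumes "\<And>H. H \<in> \<H> \<Longrightarrow> submodule H complex_ring A" "\<H> \<noteq> {}"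
  shows "submodule (\<Inter>\<H>) complex_ring A"
proof (rule complex_submoduleI)
  note s = submodule_closed[OF assms(1)]
  show "\<Inter>\<H> \<subseteq> carrier A" using s(1) assms(2) by blast
  show "\<zero>\<^bsub>A\<^esub> \<in> \<Inter>\<H>" using s(2) by blast
  show "x \<oplus>\<^bsub>A\<^esub> y \<in> \<Inter>\<H>" if "x \<in> \<Inter>\<H>" "y \<in> \<Inter>\<H>" for x y
    using that s(3) by (meson InterE InterI)
  show "c \<odot>\<^bsub>A\<^esub> x \<in> \<Inter>\<H>" if "x \<in> \<Inter>\<H>" for c x
    using that s(4) by (meson InterE InterI)
qed

end

text \<open>
  The constants \<^const>\<open>lin_span\<close>, \<^const>\<open>algebra_ideal\<close> and \<^const>\<open>quotient_algebra\<close> do not accept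
  extended module records, whereas \<^locale>\<open>complex_algebra\<close> is about those.
\<close>

locale plain_complex_algebra = complex_algebra A for A :: "(complex, 'v) module" (structure)
begin

lemma submodule_lin_span:
  assumes "B \<subseteq> carrier A"
  shows "submodule (lin_span A B) complex_ring A"
  unfolding lin_span_def hull_def
  using assms carrier_is_submodule by (intro submodule_Inter) auto

text \<open>The whole carrier is an ideal containing \<open>B\<close>, so the hull is the
  intersection of a nonempty family of ideals.\<close>

lemma algebra_ideal_hull:
  assumes "B \<subseteq> carrier A"
  shows "algebra_ideal ((\<lambda>K. algebra_ideal K A) hull B) A"
proof -
  have "algebra_ideal (carrier A) A"
    unfolding algebra_ideal_def using carrier_is_submodule by simp
  then show ?thesis
    using assms unfolding algebra_ideal_def hull_def
    by (intro conjI submodule_Inter) auto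
qed

text \<open>The target is a bare record. Facts about its zero, such as zero plus zero being zero,
  are obtained by applying \<open>f\<close> to the same identity in \<open>A\<close>.\<close>

lemma algebra_ideal_kernel:
  assumes f: "alg_hom A B f"
  shows "algebra_ideal {x \<in> carrier A. f x = \<zero>\<^bsub>B\<^esub>} A"
proof -
  note h = alg_homD[OF f]
  have *: "f x = f \<zero>\<^bsub>A\<^esub>" if "f x = \<zero>\<^bsub>B\<^esub>" for x
    using that h(2) by simp
  have "f (x \<oplus>\<^bsub>A\<^esub> y) = \<zero>\<^bsub>B\<^esub>" if "x \<in> carrier A" "y \<in> carrier A" "f x = \<zero>\<^bsub>B\<^esub>" "f y = \<zero>\<^bsub>B\<^esub>" for x y
    using that h(3)[of x y] h(3)[of "\<zero>\<^bsub>A\<^esub>" "\<zero>\<^bsub>A\<^esub>"] h(2) by simp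
  moreover have "f (c \<odot>\<^bsub>A\<^esub> x) = \<zero>\<^bsub>B\<^esub>" if "x \<in> carrier A" "f x = \<zero>\<^bsub>B\<^esub>" for c x
    using that h(4)[of x c] h(4)[of "\<zero>\<^bsub>A\<^esub>" c] h(2) smult_r_null[of c] by simp
  moreover have "f (x \<otimes>\<^bsub>A\<^esub> y) = \<zero>\<^bsub>B\<^esub>" "f (y \<otimes>\<^bsub>A\<^esub> x) = \<zero>\<^bsub>B\<^esub>"
    if "x \<in> carrier A" "y \<in> carrier A" "f y = \<zero>\<^bsub>B\<^esub>" for x y
    using that h(5)[of x y] h(5)[of x "\<zero>\<^bsub>A\<^esub>"] h(5)[of y x] h(5)[of "\<zero>\<^bsub>A\<^esub>" x] h(2) by simp_all
  ultimately show ?thesis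
    unfolding algebra_ideal_def by (auto intro!: complex_submoduleI simp: h(2))
qed

end

section \<open>Quotients by ideals and the first isomorphism theorem\<close>

lemma quotient_algebra_simps:
  "carrier (quotient_algebra A I) = {I +>\<^bsub>A\<^esub> x | x. x \<in> carrier A}"
  "x \<oplus>\<^bsub>quotient_algebra A I\<^esub> y = x <+>\<^bsub>A\<^esub> y"
  "\<zero>\<^bsub>quotient_algebra A I\<^esub> = I"
  "x \<otimes>\<^bsub>quotient_algebra A I\<^esub> y = rcoset_mult A I x y"
  "c \<odot>\<^bsub>quotient_algebra A I\<^esub> x = (\<Union>y\<in>x. I +>\<^bsub>A\<^esub> (c \<odot>\<^bsub>A\<^esub> y))"
  by (auto simp: quotient_algebra_def FactRing_def ring.defs module.defs A_RCOSETS_def'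
      a_r_coset_def')

locale ideal_of_algebra = plain_complex_algebra A for A (structure) +
  fixes I
  assumes ideal: "algebra_ideal I A"
begin

lemma ideal_submodule: "submodule I complex_ring A"
  using ideal by (simp add: algebra_ideal_def)

lemmas ideal_closed = submodule_closed[OF ideal_submodule]

lemma ideal_mult_closed:
  "x \<in> carrier A \<Longrightarrow> y \<in> I \<Longrightarrow> x \<otimes>\<^bsub>A\<^esub> y \<in> I"
  "x \<in> I \<Longrightarrow> y \<in> carrier A \<Longrightarrow> x \<otimes>\<^bsub>A\<^esub> y \<in> I"
  using ideal by (simp_all add: algebra_ideal_def)

lemma ideal_subgroup: "subgroup I (add_monoid A)"
  using ideal_submodule by (rule submodule.axioms)

sublocale abelian_subgroup I A
  by (intro abelian_subgroupI3 additive_subgroupI ideal_subgroup M.abelian_group_axioms)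

lemma coset_memD: "a \<in> I +>\<^bsub>A\<^esub> x \<Longrightarrow> \<exists>h\<in>I. a = h \<oplus>\<^bsub>A\<^esub> x"
  by (auto simp: a_r_coset_def')

lemma coset_memI: "h \<in> I \<Longrightarrow> h \<oplus>\<^bsub>A\<^esub> x \<in> I +>\<^bsub>A\<^esub> x"
  by (auto simp: a_r_coset_def')

lemma coset_eqI:
  assumes "a \<in> I +>\<^bsub>A\<^esub> x" "x \<in> carrier A"
  shows "I +>\<^bsub>A\<^esub> a = I +>\<^bsub>A\<^esub> x"
  using M.a_repr_independence[OF assms ideal_subgroup] by simp

lemma coset_eq_iff:
  assumes "x \<in> carrier A" "y \<in> carrier A"
  shows "I +>\<^bsub>A\<^esub> x = I +>\<^bsub>A\<^esub> y \<longleftrightarrow> x \<ominus>\<^bsub>A\<^esub> y \<in> I"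
proof
  assume "I +>\<^bsub>A\<^esub> x = I +>\<^bsub>A\<^esub> y"
  then obtain h where "h \<in> I" "x = h \<oplus>\<^bsub>A\<^esub> y"
    using a_rcos_self[OF assms(1)] coset_memD by blast
  then show "x \<ominus>\<^bsub>A\<^esub> y \<in> I"
    using assms ideal_closed(1) by (auto simp: a_minus_def M.a_assoc M.r_neg)
next
  assume "x \<ominus>\<^bsub>A\<^esub> y \<in> I"
  then have "x \<ominus>\<^bsub>A\<^esub> y \<oplus>\<^bsub>A\<^esub> y \<in> I +>\<^bsub>A\<^esub> y"
    by (rule coset_memI)
  then have "x \<in> I +>\<^bsub>A\<^esub> y"
    using assms by (simp add: a_minus_def M.a_assoc M.l_neg)
  then show "I +>\<^bsub>A\<^esub> x = I +>\<^bsub>A\<^esub> y"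
    using assms coset_eqI by simp
qed

text \<open>Product and scalar action on cosets are unions over all representatives. Each union
  collapses to a single coset once all choices of representatives are shown to give the same
  one.\<close>

lemma coset_hom: "alg_hom A (quotient_algebra A I) (\<lambda>x. I +>\<^bsub>A\<^esub> x)"
  unfolding alg_hom_def quotient_algebra_simps
proof (intro conjI ballI allI)
  fix x assume x: "x \<in> carrier A"
  show "I +>\<^bsub>A\<^esub> x \<in> {I +>\<^bsub>A\<^esub> x |x. x \<in> carrier A}" using x by blast
  fix c
  have "c \<odot>\<^bsub>A\<^esub> a \<in> I +>\<^bsub>A\<^esub> (c \<odot>\<^bsub>A\<^esub> x)" if "a \<in> I +>\<^bsub>A\<^esub> x" for a
  proof -
    obtain h where "h \<in> I" "a = h \<oplus>\<^bsub>A\<^esub> x" using coset_memD \<open>a \<in> _\<close> by blast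
    moreover have "c \<odot>\<^bsub>A\<^esub> h \<oplus>\<^bsub>A\<^esub> c \<odot>\<^bsub>A\<^esub> x \<in> I +>\<^bsub>A\<^esub> (c \<odot>\<^bsub>A\<^esub> x)"
      using \<open>h \<in> I\<close> ideal_closed by (intro coset_memI) auto
    ultimately show ?thesis
      using x ideal_closed(1) by (subst \<open>a = _\<close>, subst smult_r_distr) auto
  qed
  then have "I +>\<^bsub>A\<^esub> (c \<odot>\<^bsub>A\<^esub> a) = I +>\<^bsub>A\<^esub> (c \<odot>\<^bsub>A\<^esub> x)" if "a \<in> I +>\<^bsub>A\<^esub> x" for a
    using x that coset_eqI by simp
  then show "I +>\<^bsub>A\<^esub> (c \<odot>\<^bsub>A\<^esub> x) = (\<Union>y\<in>I +>\<^bsub>A\<^esub> x. I +>\<^bsub>A\<^esub> (c \<odot>\<^bsub>A\<^esub> y))"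
    using a_rcos_self[OF x] by blast
next
  show "I +>\<^bsub>A\<^esub> \<zero>\<^bsub>A\<^esub> = I" using ideal_closed(1) by simp
next
  fix x y assume x: "x \<in> carrier A" and y: "y \<in> carrier A"
  show "I +>\<^bsub>A\<^esub> (x \<oplus>\<^bsub>A\<^esub> y) = (I +>\<^bsub>A\<^esub> x) <+>\<^bsub>A\<^esub> (I +>\<^bsub>A\<^esub> y)"
    using x y by (simp add: a_rcos_sum)
  have "a \<otimes>\<^bsub>A\<^esub> b \<in> I +>\<^bsub>A\<^esub> (x \<otimes>\<^bsub>A\<^esub> y)" if ab: "a \<in> I +>\<^bsub>A\<^esub> x" "b \<in> I +>\<^bsub>A\<^esub> y" for a b
  proof -
    obtain h k where hk: "h \<in> I" "a = h \<oplus>\<^bsub>A\<^esub> x" "k \<in> I" "b = k \<oplus>\<^bsub>A\<^esub> y"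
      using coset_memD ab by meson
    then have hc: "h \<in> carrier A" "k \<in> carrier A" using ideal_closed(1) by auto
    \<comment> \<open>Expanding the product of \<open>h + x\<close> and \<open>k + y\<close>, every
      term except the product of \<open>x\<close> and \<open>y\<close> has a factor in the
      ideal.\<close>
    have "a \<otimes>\<^bsub>A\<^esub> b = (h \<otimes>\<^bsub>A\<^esub> (k \<oplus>\<^bsub>A\<^esub> y) \<oplus>\<^bsub>A\<^esub> x \<otimes>\<^bsub>A\<^esub> k) \<oplus>\<^bsub>A\<^esub> x \<otimes>\<^bsub>A\<^esub> y"
      using x y hk(2,4) hc by (simp add: prod_add_left prod_add_right M.a_ac)
    also have "\<dots> \<in> I +>\<^bsub>A\<^esub> (x \<otimes>\<^bsub>A\<^esub> y)"
      using x y hk(1,3) hc by (intro coset_memI ideal_closed(3) ideal_mult_closed) auto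
    finally show ?thesis .
  qed
  then have "I +>\<^bsub>A\<^esub> (a \<otimes>\<^bsub>A\<^esub> b) = I +>\<^bsub>A\<^esub> (x \<otimes>\<^bsub>A\<^esub> y)"
    if "a \<in> I +>\<^bsub>A\<^esub> x" "b \<in> I +>\<^bsub>A\<^esub> y" for a b
    using x y that coset_eqI by simp
  then show "I +>\<^bsub>A\<^esub> (x \<otimes>\<^bsub>A\<^esub> y) = rcoset_mult A I (I +>\<^bsub>A\<^esub> x) (I +>\<^bsub>A\<^esub> y)"
    unfolding rcoset_mult_def using a_rcos_self[OF x] a_rcos_self[OF y] by blast
qed

lemma coset_surj: "(\<lambda>x. I +>\<^bsub>A\<^esub> x) ` carrier A = carrier (quotient_algebra A I)"
  by (auto simp: quotient_algebra_simps)

lemma complex_algebra_quotient: "complex_algebra (quotient_algebra A I)"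
  using coset_hom coset_surj by (rule complex_algebra_hom_image)

text \<open>Universal property of the quotient: \<open>f\<close> is constant on cosets, so
  evaluating it at a chosen representative gives a well-behaved map.\<close>

lemma quotient_lift:
  assumes f: "alg_hom A B f" and ker: "\<And>x. x \<in> I \<Longrightarrow> f x = \<zero>\<^bsub>B\<^esub>"
  shows "\<exists>g. alg_hom (quotient_algebra A I) B g \<and> (\<forall>x\<in>carrier A. g (I +>\<^bsub>A\<^esub> x) = f x)"
proof -
  note h = alg_homD[OF f] and q = alg_homD[OF coset_hom]
  have f_coset: "f a = f x" if xa: "x \<in> carrier A" "a \<in> I +>\<^bsub>A\<^esub> x" for x a
  proof -
    obtain k where k: "k \<in> I" "a = k \<oplus>\<^bsub>A\<^esub> x" using coset_memD[OF xa(2)] by blast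
    \<comment> \<open>The zero of \<open>B\<close> is written as the image of the zero of
      \<open>A\<close>, because its neutrality is available only on the image of
      \<open>f\<close>.\<close>
    then have "f a = f \<zero>\<^bsub>A\<^esub> \<oplus>\<^bsub>B\<^esub> f x"
      using that ideal_closed(1) ker h(2,3) by auto
    also have "\<dots> = f x"
      using that h(3)[of "\<zero>\<^bsub>A\<^esub>" x] by simp
    finally show ?thesis .
  qed
  let ?g = "\<lambda>C. f (SOME x. x \<in> C)"
  have g: "?g (I +>\<^bsub>A\<^esub> x) = f x" if "x \<in> carrier A" for x
    using f_coset[OF that] a_rcos_self[OF that] by (metis someI)
  have onto: "\<exists>x\<in>carrier A. C = I +>\<^bsub>A\<^esub> x" if "C \<in> carrier (quotient_algebra A I)" for C
    using that by (auto simp: quotient_algebra_simps)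
  have "alg_hom (quotient_algebra A I) B ?g"
    unfolding alg_hom_def
  proof (intro conjI ballI allI)
    fix C c assume "C \<in> carrier (quotient_algebra A I)"
    then obtain x where x: "x \<in> carrier A" "C = I +>\<^bsub>A\<^esub> x" using onto by blast
    show "?g C \<in> carrier B" using x g h(1) by simp
    show "?g (c \<odot>\<^bsub>quotient_algebra A I\<^esub> C) = c \<odot>\<^bsub>B\<^esub> ?g C"
      using x by (simp add: q(4)[symmetric] g h(4))
  next
    show "?g \<zero>\<^bsub>quotient_algebra A I\<^esub> = \<zero>\<^bsub>B\<^esub>"
      by (simp add: q(2)[symmetric] g h(2))
  next
    fix C D assume "C \<in> carrier (quotient_algebra A I)" "D \<in> carrier (quotient_algebra A I)"
    then obtain x y where x: "x \<in> carrier A" "C = I +>\<^bsub>A\<^esub> x" "y \<in> carrier A" "D = I +>\<^bsub>A\<^esub> y"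
      using onto by meson
    show "?g (C \<oplus>\<^bsub>quotient_algebra A I\<^esub> D) = ?g C \<oplus>\<^bsub>B\<^esub> ?g D"
      "?g (C \<otimes>\<^bsub>quotient_algebra A I\<^esub> D) = ?g C \<otimes>\<^bsub>B\<^esub> ?g D"
      using x by (simp_all add: q(3,5)[symmetric] g h(3,5))
  qed
  with g show ?thesis by blast
qed

end

text \<open>First isomorphism theorem for the bare operations. That both sides are Lie algebras is
  supplied by \<open>lie_algebra_hom_image\<close>.\<close>

lemma (in plain_complex_algebra) quotient_kernel_iso:
  assumes f: "alg_hom A B f" and surj: "f ` carrier A = carrier B"
  shows "lie_iso (quotient_algebra A {x \<in> carrier A. f x = \<zero>\<^bsub>B\<^esub>}) B \<noteq> {}"
proof -
  note h = alg_homD[OF f]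
  define I where "I = {x \<in> carrier A. f x = \<zero>\<^bsub>B\<^esub>}"
  interpret ideal_of_algebra A I
    unfolding I_def
    by (intro ideal_of_algebra.intro ideal_of_algebra_axioms.intro algebra_ideal_kernel[OF f]
        plain_complex_algebra_axioms)
  have ker: "f x = \<zero>\<^bsub>B\<^esub>" if "x \<in> I" for x
    using that unfolding I_def by blast
  obtain g where g: "alg_hom (quotient_algebra A I) B g"
    and gf: "\<And>x. x \<in> carrier A \<Longrightarrow> g (I +>\<^bsub>A\<^esub> x) = f x"
    using quotient_lift[OF f ker] by blast
  have "inj_on g (carrier (quotient_algebra A I))"
  proof (rule inj_onI)
    fix C D assume "C \<in> carrier (quotient_algebra A I)" "D \<in> carrier (quotient_algebra A I)"
      and eq: "g C = g D"
    then obtain x y where x: "x \<in> carrier A" "C = I +>\<^bsub>A\<^esub> x" and y: "y \<in> carrier A" "D = I +>\<^bsub>A\<^esub> y"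
      unfolding coset_surj[symmetric] by blast
    have "f x = f y" using eq gf x y by metis
    \<comment> \<open>Comparing with \<open>y\<close> minus itself replaces a subtraction in
      \<open>B\<close>, where no group laws are at hand.\<close>
    then have "f (x \<ominus>\<^bsub>A\<^esub> y) = f (y \<ominus>\<^bsub>A\<^esub> y)"
      unfolding a_minus_def using x(1) y(1) by (simp only: h(3) M.a_inv_closed)
    also have "\<dots> = \<zero>\<^bsub>B\<^esub>" using y(1) h(2) by (simp only: a_minus_def M.r_neg)
    finally have "x \<ominus>\<^bsub>A\<^esub> y \<in> I" using x(1) y(1) unfolding I_def by blast
    then show "C = D" using x y coset_eq_iff by blast
  qed
  moreover have "g ` carrier (quotient_algebra A I) = carrier B"
    unfolding coset_surj[symmetric] surj[symmetric] image_image using gf by simp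
  ultimately have "g \<in> lie_iso (quotient_algebra A I) B"
    using alg_homD[OF g] unfolding lie_iso_def bij_betw_def by simp
  then show ?thesis unfolding I_def by blast
qed

text \<open>Used for the quotient and for \<open>AS_tau S\<close>. In the second case it takes the
  place of a direct check that the \<tau>-fixed matrices are closed under the bracket.\<close>

lemma (in lie_algebra) lie_algebra_hom_image:
  assumes f: "alg_hom L B f" and surj: "f ` carrier L = carrier B"
  shows "lie_algebra B"
proof -
  note h = alg_homD[OF f]
  have onto: "\<exists>a\<in>carrier L. x = f a" if "x \<in> carrier B" for x
    using that surj by blast
  have "lie_algebra_axioms B"
  proof (rule lie_algebra_axioms.intro)
    fix x assume "x \<in> carrier B"
    then obtain a where "a \<in> carrier L" "x = f a" using onto by metis
    then show "x \<otimes>\<^bsub>B\<^esub> x = \<zero>\<^bsub>B\<^esub>" by (simp add: h(2,5)[symmetric] alternating)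
  next
    fix x y z assume "x \<in> carrier B" "y \<in> carrier B" "z \<in> carrier B"
    then obtain a b c where "a \<in> carrier L" "x = f a" "b \<in> carrier L" "y = f b"
      "c \<in> carrier L" "z = f c"
      using onto by metis
    then show "x \<otimes>\<^bsub>B\<^esub> (y \<otimes>\<^bsub>B\<^esub> z) \<oplus>\<^bsub>B\<^esub> y \<otimes>\<^bsub>B\<^esub> (z \<otimes>\<^bsub>B\<^esub> x) \<oplus>\<^bsub>B\<^esub> z \<otimes>\<^bsub>B\<^esub> (x \<otimes>\<^bsub>B\<^esub> y) = \<zero>\<^bsub>B\<^esub>"
      by (simp add: h(2,3,5)[symmetric] jacobi)
  qed
  then show ?thesis
    using complex_algebra_hom_image[OF f surj] by (intro lie_algebra.intro)
qed

section \<open>Linear and bilinear extensions\<close>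

lemma lookup_scale_vec [simp]:
  "Poly_Mapping.lookup (scale_vec c x) k = c * Poly_Mapping.lookup x k"
  by (simp add: scale_vec_def Poly_Mapping.map.rep_eq when_def)

interpretation vec: vector_space "scale_vec :: complex \<Rightarrow> ('k \<Rightarrow>\<^sub>0 complex) \<Rightarrow> _"
  by unfold_locales
    (auto intro!: poly_mapping_eqI simp: lookup_add algebra_simps)

abbreviation vec_linear :: "(('i \<Rightarrow>\<^sub>0 complex) \<Rightarrow> ('k \<Rightarrow>\<^sub>0 complex)) \<Rightarrow> bool" where
  "vec_linear \<equiv> Vector_Spaces.linear scale_vec scale_vec"

lemma vec_linearI:
  assumes "\<And>x y. f (x + y) = f x + f y" "\<And>c x. f (scale_vec c x) = scale_vec c (f x)"
  shows "vec_linear f"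
  using assms
  by (intro Vector_Spaces.linear.intro module_hom.intro module_hom_axioms.intro
      vec.vector_space_axioms vec.module_axioms)

lemma vec_linearD:
  assumes "vec_linear f"
  shows "f (x + y) = f x + f y" "f (scale_vec c x) = scale_vec c (f x)"
    "f 0 = 0" "f (- x) = - f x" "f (x - y) = f x - f y" "f (sum g A) = (\<Sum>a\<in>A. f (g a))"
proof -
  interpret Vector_Spaces.linear scale_vec scale_vec f by fact
  show "f (x + y) = f x + f y" "f (scale_vec c x) = scale_vec c (f x)"
    "f 0 = 0" "f (- x) = - f x" "f (x - y) = f x - f y" "f (sum g A) = (\<Sum>a\<in>A. f (g a))"
    by (fact add scale zero neg diff sum)+
qed

text \<open>The supports of \<open>x\<close>, \<open>y\<close> and \<open>x + y\<close> differ;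
  summing over a common finite index set makes the three sums comparable.\<close>

lemma linear_extension_finite_superset:
  assumes "finite A" "Poly_Mapping.keys x \<subseteq> A"
  shows "linear_extension f x = (\<Sum>i\<in>A. scale_vec (Poly_Mapping.lookup x i) (f i))"
  unfolding linear_extension_def
  using assms by (intro sum.mono_neutral_left) (auto simp: in_keys_iff)

lemma vec_linear_linear_extension: "vec_linear (linear_extension f)"
proof (rule vec_linearI)
  fix x y :: "'a \<Rightarrow>\<^sub>0 complex" and c
  define A where "A = Poly_Mapping.keys x \<union> Poly_Mapping.keys y \<union> Poly_Mapping.keys (x + y)
    \<union> Poly_Mapping.keys (scale_vec c x)"
  have "finite A" unfolding A_def by simp
  then have *: "linear_extension f z = (\<Sum>i\<in>A. scale_vec (Poly_Mapping.lookup z i) (f i))"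
    if "Poly_Mapping.keys z \<subseteq> A" for z
    using that by (rule linear_extension_finite_superset)
  show "linear_extension f (x + y) = linear_extension f x + linear_extension f y"
    using *[of x] *[of y] *[of "x + y"]
    by (simp add: A_def lookup_add vec.scale_left_distrib sum.distrib Un_assoc subset_eq)
  show "linear_extension f (scale_vec c x) = scale_vec c (linear_extension f x)"
    using *[of x] *[of "scale_vec c x"]
    by (simp add: A_def vec.scale_sum_right subset_eq)
qed

lemma linear_extension_basis [simp]: "linear_extension f (basis_vec k) = f k"
  by (simp add: linear_extension_def basis_vec_def)

lemma linear_extension_basis_vec: "linear_extension basis_vec x = x"
proof (rule poly_mapping_eqI)
  fix k
  show "Poly_Mapping.lookup (linear_extension basis_vec x) k = Poly_Mapping.lookup x k"
    by (auto simp: linear_extension_def lookup_sum basis_vec_def lookup_single when_def in_keys_iff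
        if_distrib cong: if_cong)
qed

lemma subspace_basis_induct:
  assumes "vec.subspace V" "\<And>k. basis_vec k \<in> V"
  shows "x \<in> V"
proof -
  have "linear_extension basis_vec x \<in> V"
    unfolding linear_extension_def
    using assms by (intro vec.subspace_sum vec.subspace_scale)
  then show ?thesis by (simp add: linear_extension_basis_vec)
qed

lemma vec_linear_eq_on_basis:
  assumes f: "vec_linear f" and g: "vec_linear g" and eq: "\<And>k. f (basis_vec k) = g (basis_vec k)"
  shows "f x = g x"
proof -
  have "vec.subspace {x. f x = g x}"
    by (auto simp: vec.subspace_def vec_linearD[OF f] vec_linearD[OF g])
  from subspace_basis_induct[OF this] eq show ?thesis by blast
qed

text \<open>Nesting two linear extensions, in this order and in the opposite one below, gives
  linearity in either argument for free.\<close>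

lemma bilinear_extension_conv_left:
  "bilinear_extension f x y = linear_extension (\<lambda>i. linear_extension (f i) y) x"
  by (simp add: bilinear_extension_def linear_extension_def vec.scale_sum_right)

lemma bilinear_extension_conv_right:
  "bilinear_extension f x y = linear_extension (\<lambda>j. linear_extension (\<lambda>i. f i j) x) y"
  by (subst sum.swap[where A="Poly_Mapping.keys y"] |
      simp add: bilinear_extension_def linear_extension_def vec.scale_sum_right mult.commute)+

lemma vec_linear_bilinear_left: "vec_linear (\<lambda>x. bilinear_extension f x y)"
  unfolding bilinear_extension_conv_left by (rule vec_linear_linear_extension)

lemma vec_linear_bilinear_right: "vec_linear (bilinear_extension f x)"
  unfolding bilinear_extension_conv_right by (rule vec_linear_linear_extension)

lemmas bilinear_extension_simps =
  vec_linearD[OF vec_linear_bilinear_left] vec_linearD[OF vec_linear_bilinear_right]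

lemma bilinear_extension_basis [simp]: "bilinear_extension f (basis_vec i) (basis_vec j) = f i j"
  by (simp add: bilinear_extension_conv_left)

lemma vec_linear_compose: "vec_linear f \<Longrightarrow> vec_linear g \<Longrightarrow> vec_linear (\<lambda>x. f (g x))"
  by (rule vec_linearI) (simp_all add: vec_linearD)

lemma vec_linear_diff: "vec_linear f \<Longrightarrow> vec_linear g \<Longrightarrow> vec_linear (\<lambda>x. f x - g x)"
  by (rule vec_linearI) (simp_all add: vec_linearD vec.scale_right_diff_distrib)

lemma algebra_on_basis_simps [simp]:
  "carrier (algebra_on_basis m) = UNIV"
  "x \<otimes>\<^bsub>algebra_on_basis m\<^esub> y = bilinear_extension m x y"
  "x \<oplus>\<^bsub>algebra_on_basis m\<^esub> y = x + y"
  "\<zero>\<^bsub>algebra_on_basis m\<^esub> = 0"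
  "c \<odot>\<^bsub>algebra_on_basis m\<^esub> x = scale_vec c x"
  by (simp_all add: algebra_on_basis_def)

lemma complex_algebra_on_basis: "complex_algebra (algebra_on_basis m)"
proof (intro complex_algebra.intro complex_algebra_axioms.intro moduleI cring_from_type_algebra)
  have "\<exists>y. y + x = 0" for x :: "'a \<Rightarrow>\<^sub>0 complex"
    using left_minus by blast
  then show "abelian_group (algebra_on_basis m)"
    by (intro abelian_groupI) (simp_all add: add.assoc add.commute)
qed (simp_all add: bilinear_extension_simps vec.scale_left_distrib vec.scale_right_distrib)

interpretation basis_alg: plain_complex_algebra "algebra_on_basis m" for m
  by (intro plain_complex_algebra.intro complex_algebra_on_basis)

lemma algebra_on_basis_minus [simp]:
  "\<ominus>\<^bsub>algebra_on_basis m\<^esub> x = - x" "x \<ominus>\<^bsub>algebra_on_basis m\<^esub> y = x - y"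
proof -
  show "\<ominus>\<^bsub>algebra_on_basis m\<^esub> x = - x" for x
    by (rule basis_alg.M.minus_equality) simp_all
  then show "x \<ominus>\<^bsub>algebra_on_basis m\<^esub> y = x - y"
    by (simp add: a_minus_def)
qed

text \<open>Bridge from the record-based notions to library vector spaces, which makes spans and
  span induction available.\<close>

lemma submodule_algebra_on_basis_iff:
  "submodule H complex_ring (algebra_on_basis m) \<longleftrightarrow> vec.subspace H"
proof
  assume "submodule H complex_ring (algebra_on_basis m)"
  note s = basis_alg.submodule_closed[OF this]
  show "vec.subspace H" unfolding vec.subspace_def
    using s(2-4) by simp
next
  assume "vec.subspace H"
  then show "submodule H complex_ring (algebra_on_basis m)"
    by (intro basis_alg.complex_submoduleI) (simp_all add: vec.subspace_def)
qed

lemma lin_span_algebra_on_basis: "lin_span (algebra_on_basis m) B = vec.span B"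
  unfolding lin_span_def submodule_algebra_on_basis_iff vec.span_def ..

lemma algebra_ideal_on_basis_iff:
  "algebra_ideal K (algebra_on_basis m) \<longleftrightarrow> vec.subspace K \<and>
     (\<forall>x. \<forall>y\<in>K. bilinear_extension m x y \<in> K \<and> bilinear_extension m y x \<in> K)"
  by (simp add: algebra_ideal_def submodule_algebra_on_basis_iff)

section \<open>Presented Lie algebras\<close>

lemma free_bracket_simps:
  "free_bracket x y = bilinear_extension (\<lambda>u v. basis_vec (Br u v)) x y"
  by (simp add: free_algebra_def)

lemmas free_bracket_linear = bilinear_extension_simps[of "\<lambda>u v. basis_vec (Br u v)",
    folded free_bracket_simps]

lemma free_algebra_simps [simp]:
  "carrier free_algebra = UNIV"
  "x \<oplus>\<^bsub>free_algebra\<^esub> y = x + y"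
  "\<zero>\<^bsub>free_algebra\<^esub> = 0"
  "c \<odot>\<^bsub>free_algebra\<^esub> x = scale_vec c x"
  "x \<ominus>\<^bsub>free_algebra\<^esub> y = x - y"
  by (simp_all add: free_algebra_def)

lemma algebra_ideal_relation_ideal: "algebra_ideal (relation_ideal R) free_algebra"
  unfolding relation_ideal_def free_algebra_def
  by (rule basis_alg.algebra_ideal_hull) simp

interpretation relation: ideal_of_algebra free_algebra "relation_ideal R" for R
  unfolding free_algebra_def
  by (intro ideal_of_algebra.intro ideal_of_algebra_axioms.intro
      basis_alg.plain_complex_algebra_axioms algebra_ideal_relation_ideal[unfolded free_algebra_def])

lemma relation_ideal_superset: "lie_axiom_elements \<subseteq> relation_ideal R" "R \<subseteq> relation_ideal R"
  using hull_subset[of "lie_axiom_elements \<union> R"] unfolding relation_ideal_def by auto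

abbreviation presented_coset :: "('x magma \<Rightarrow>\<^sub>0 complex) set \<Rightarrow> _ \<Rightarrow> _" where
  "presented_coset R x \<equiv> relation_ideal R +>\<^bsub>free_algebra\<^esub> x"

lemma presented_coset_hom: "alg_hom free_algebra (presented_lie_algebra R) (presented_coset R)"
  unfolding presented_lie_algebra_def by (rule relation.coset_hom)

lemma carrier_presented_lie_algebra: "carrier (presented_lie_algebra R) = range (presented_coset R)"
  by (auto simp: presented_lie_algebra_def quotient_algebra_simps)

lemma presented_coset_zero:
  assumes "x \<in> relation_ideal R"
  shows "presented_coset R x = \<zero>\<^bsub>presented_lie_algebra R\<^esub>"
proof -
  have "presented_coset R x = presented_coset R 0"
    using assms by (subst relation.coset_eq_iff) simp_all
  then show ?thesis using alg_homD(2)[OF presented_coset_hom, of R] by simp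
qed

text \<open>\<open>lie_axiom_elements\<close> ranges over all elements of the free algebra, not only
  over words, so any representatives of the given cosets witness the axioms directly.\<close>

lemma lie_algebra_presented: "lie_algebra (presented_lie_algebra R)"
proof (intro lie_algebra.intro lie_algebra_axioms.intro)
  show "complex_algebra (presented_lie_algebra R)"
    unfolding presented_lie_algebra_def by (rule relation.complex_algebra_quotient)
  fix x assume "x \<in> carrier (presented_lie_algebra R)"
  then obtain a where a: "x = presented_coset R a" by (auto simp: carrier_presented_lie_algebra)
  have "free_bracket a a \<in> relation_ideal R"
    using relation_ideal_superset(1) unfolding lie_axiom_elements_def by blast
  then show "x \<otimes>\<^bsub>presented_lie_algebra R\<^esub> x = \<zero>\<^bsub>presented_lie_algebra R\<^esub>"
    unfolding a
    using presented_coset_zero alg_homD(5)[OF presented_coset_hom, of a a R]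
    by (metis UNIV_I free_algebra_simps(1))
next
  fix x y z
  assume "x \<in> carrier (presented_lie_algebra R)" "y \<in> carrier (presented_lie_algebra R)"
    "z \<in> carrier (presented_lie_algebra R)"
  then obtain a b c where abc: "x = presented_coset R a" "y = presented_coset R b"
    "z = presented_coset R c" by (auto simp: carrier_presented_lie_algebra)
  let ?j = "free_bracket a (free_bracket b c) + free_bracket b (free_bracket c a)
    + free_bracket c (free_bracket a b)"
  have "?j \<in> relation_ideal R"
    using relation_ideal_superset(1) unfolding lie_axiom_elements_def by blast
  then have "presented_coset R ?j = \<zero>\<^bsub>presented_lie_algebra R\<^esub>"
    by (rule presented_coset_zero)
  then show "x \<otimes>\<^bsub>presented_lie_algebra R\<^esub> (y \<otimes>\<^bsub>presented_lie_algebra R\<^esub> z)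
      \<oplus>\<^bsub>presented_lie_algebra R\<^esub> y \<otimes>\<^bsub>presented_lie_algebra R\<^esub> (z \<otimes>\<^bsub>presented_lie_algebra R\<^esub> x)
      \<oplus>\<^bsub>presented_lie_algebra R\<^esub> z \<otimes>\<^bsub>presented_lie_algebra R\<^esub> (x \<otimes>\<^bsub>presented_lie_algebra R\<^esub> y)
      = \<zero>\<^bsub>presented_lie_algebra R\<^esub>"
    unfolding abc
    by (simp add: alg_homD(5)[OF presented_coset_hom, symmetric]
        alg_homD(3)[OF presented_coset_hom, symmetric, simplified])
qed

text \<open>If brackets of generators are linear combinations of generators modulo the ideal, then
  this span is closed under the bracket, first in the right and then in the left argument. By
  induction on words it contains every basis vector.\<close>

lemma relation_ideal_gen_span:
  assumes gens: "\<And>x y. free_bracket (free_gen x) (free_gen y)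
      \<in> vec.span (relation_ideal R \<union> range free_gen)"
  shows "vec.span (relation_ideal R \<union> range free_gen) = UNIV"
proof -
  let ?T = "vec.span (relation_ideal R \<union> range free_gen)"
  have K: "x \<in> ?T" if "x \<in> relation_ideal R" for x
    using that by (simp add: vec.span_base)
  have left: "free_bracket x y \<in> ?T" if "y \<in> ?T" "x \<in> relation_ideal R \<union> range free_gen" for x y
    using that(1)
  proof (rule vec.span_induct)
    show "vec.subspace {y. free_bracket x y \<in> ?T}"
      by (auto simp: vec.subspace_def free_bracket_linear vec.span_add vec.span_scale vec.span_zero)
    show "free_bracket x y \<in> ?T" if "y \<in> relation_ideal R \<union> range free_gen" for y
    proof (cases "x \<in> relation_ideal R \<or> y \<in> relation_ideal R")
      case True
      then have "free_bracket x y \<in> relation_ideal R"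
        using relation.ideal_mult_closed by auto
      then show ?thesis by (rule K)
    qed (use that \<open>x \<in> _\<close> gens in blast)
  qed
  have bracket: "free_bracket x y \<in> ?T" if "x \<in> ?T" "y \<in> ?T" for x y
    using that(1)
  proof (rule vec.span_induct)
    show "vec.subspace {x. free_bracket x y \<in> ?T}"
      by (auto simp: vec.subspace_def free_bracket_linear vec.span_add vec.span_scale vec.span_zero)
  qed (use left that in blast)
  have "basis_vec u \<in> ?T" for u
  proof (induction u)
    case (Gen x)
    then show ?case by (auto intro!: vec.span_base simp: free_gen_def)
  next
    case (Br u v)
    then show ?case using bracket[of "basis_vec u" "basis_vec v"] by (simp add: free_bracket_simps)
  qed
  then show ?thesis
    using subspace_basis_induct[of ?T] by auto
qed

section \<open>Universal properties of the free algebra and of a presentation\<close>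

primrec magma_eval :: "('x \<Rightarrow> 'v) \<Rightarrow> ('v \<Rightarrow> 'v \<Rightarrow> 'v) \<Rightarrow> 'x magma \<Rightarrow> 'v" where
  "magma_eval g b (Gen x) = g x"
| "magma_eval g b (Br u v) = b (magma_eval g b u) (magma_eval g b v)"

definition free_lift ::
  "('x \<Rightarrow> ('k \<Rightarrow>\<^sub>0 complex)) \<Rightarrow> (('k \<Rightarrow>\<^sub>0 complex) \<Rightarrow> ('k \<Rightarrow>\<^sub>0 complex) \<Rightarrow> ('k \<Rightarrow>\<^sub>0 complex)) \<Rightarrow>
    ('x magma \<Rightarrow>\<^sub>0 complex) \<Rightarrow> ('k \<Rightarrow>\<^sub>0 complex)" where
  "free_lift g b = linear_extension (magma_eval g b)"

lemma vec_linear_free_lift: "vec_linear (free_lift g b)"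
  unfolding free_lift_def by (rule vec_linear_linear_extension)

lemmas free_lift_simps = vec_linearD[OF vec_linear_free_lift]

lemma free_lift_gen [simp]: "free_lift g b (free_gen x) = g x"
  by (simp add: free_lift_def free_gen_def)

text \<open>Both sides are bilinear, and on words the claim is the recursion equation of
  \<open>magma_eval\<close> for \<open>Br\<close>.\<close>

lemma free_lift_bracket:
  assumes left: "\<And>y. vec_linear (\<lambda>x. b x y)" and right: "\<And>x. vec_linear (b x)"
  shows "free_lift g b (free_bracket x y) = b (free_lift g b x) (free_lift g b y)"
proof (rule vec_linear_eq_on_basis[where x=x])
  show "vec_linear (\<lambda>x. free_lift g b (free_bracket x y))"
    by (rule vec_linearI) (simp_all add: free_bracket_linear free_lift_simps)
  show "vec_linear (\<lambda>x. b (free_lift g b x) (free_lift g b y))"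
    by (rule vec_linear_compose[OF left vec_linear_free_lift])
  fix u
  show "free_lift g b (free_bracket (basis_vec u) y) = b (free_lift g b (basis_vec u)) (free_lift g b y)"
  proof (rule vec_linear_eq_on_basis[where x=y])
    show "vec_linear (\<lambda>y. free_lift g b (free_bracket (basis_vec u) y))"
      by (rule vec_linearI) (simp_all add: free_bracket_linear free_lift_simps)
    show "vec_linear (\<lambda>y. b (free_lift g b (basis_vec u)) (free_lift g b y))"
      by (rule vec_linear_compose[OF right vec_linear_free_lift])
  qed (simp add: free_bracket_simps free_lift_def)
qed

text \<open>The kernel of the lift is an ideal containing the Lie axiom elements and
  \<open>R\<close>, hence contains the ideal they generate. So the lift descends to the presented
  Lie algebra.\<close>

lemma relation_ideal_free_lift_zero:
  assumes left: "\<And>y. vec_linear (\<lambda>x. b x y)" and right: "\<And>x. vec_linear (b x)"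
    and alt: "\<And>x. b x x = 0"
    and jacobi: "\<And>x y z. b x (b y z) + b y (b z x) + b z (b x y) = 0"
    and rel: "\<And>r. r \<in> R \<Longrightarrow> free_lift g b r = 0"
    and x: "x \<in> relation_ideal R"
  shows "free_lift g b x = 0"
proof -
  note bracket = free_lift_bracket[of b, OF left right]
  have "algebra_ideal {x. free_lift g b x = 0} free_algebra"
    unfolding free_algebra_def algebra_ideal_on_basis_iff vec.subspace_def
    by (auto simp: free_lift_simps bracket free_bracket_simps[symmetric]
        vec_linearD(3)[OF left] vec_linearD(3)[OF right])
  moreover have "lie_axiom_elements \<union> R \<subseteq> {x. free_lift g b x = 0}"
    unfolding lie_axiom_elements_def
    by (auto simp: free_lift_simps bracket alt jacobi rel)
  ultimately have "relation_ideal R \<subseteq> {x. free_lift g b x = 0}"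
    unfolding relation_ideal_def by (intro hull_minimal)
  then show ?thesis using x by blast
qed

section \<open>Finitary matrices\<close>

definition gl_mult :: "'a glS \<Rightarrow> 'a glS \<Rightarrow> 'a glS" where
  "gl_mult = bilinear_extension (\<lambda>(\<alpha>, \<beta>) (\<mu>, \<nu>). (glS_E \<alpha> \<nu> when \<beta> = \<mu>))"

lemma vec_linear_gl_mult: "vec_linear (\<lambda>x. gl_mult x y)" "vec_linear (gl_mult x)"
  unfolding gl_mult_def by (rule vec_linear_bilinear_left, rule vec_linear_bilinear_right)

lemmas gl_mult_linear = vec_linear_gl_mult[THEN vec_linearD(1)] vec_linear_gl_mult[THEN vec_linearD(2)]
  vec_linear_gl_mult[THEN vec_linearD(3)] vec_linear_gl_mult[THEN vec_linearD(5)]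

lemma gl_mult_E: "gl_mult (glS_E \<alpha> \<beta>) (glS_E \<mu> \<nu>) = (glS_E \<alpha> \<nu> when \<beta> = \<mu>)"
  by (simp add: gl_mult_def glS_E_def)

text \<open>Both sides are linear in each argument, which reduces the claim to matrix units.\<close>

lemma gl_mult_assoc: "gl_mult (gl_mult x y) z = gl_mult x (gl_mult y z)"
proof (rule vec_linear_eq_on_basis[where x=x])
  fix i
  show "gl_mult (gl_mult (basis_vec i) y) z = gl_mult (basis_vec i) (gl_mult y z)"
  proof (rule vec_linear_eq_on_basis[where x=y])
    fix j
    show "gl_mult (gl_mult (basis_vec i) (basis_vec j)) z = gl_mult (basis_vec i) (gl_mult (basis_vec j) z)"
    proof (rule vec_linear_eq_on_basis[where x=z])
      fix k
      show "gl_mult (gl_mult (basis_vec i) (basis_vec j)) (basis_vec k)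
          = gl_mult (basis_vec i) (gl_mult (basis_vec j) (basis_vec k))"
        by (cases i; cases j; cases k)
          (simp add: when_def gl_mult_E gl_mult_linear flip: glS_E_def)
    qed (rule vec_linearI; simp add: gl_mult_linear)+
  qed (rule vec_linearI; simp add: gl_mult_linear)+
qed (rule vec_linearI; simp add: gl_mult_linear)+

definition gl_bracket :: "'a glS \<Rightarrow> 'a glS \<Rightarrow> 'a glS" where
  "gl_bracket x y = gl_mult x y - gl_mult y x"

lemma vec_linear_gl_bracket: "vec_linear (\<lambda>x. gl_bracket x y)" "vec_linear (gl_bracket x)"
  unfolding gl_bracket_def by (intro vec_linear_diff vec_linear_gl_mult)+

lemma gl_bracket_alternating: "gl_bracket x x = 0"
  by (simp add: gl_bracket_def)

lemma gl_bracket_jacobi: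
  "gl_bracket x (gl_bracket y z) + gl_bracket y (gl_bracket z x) + gl_bracket z (gl_bracket x y) = 0"
  by (simp add: gl_bracket_def gl_mult_linear gl_mult_assoc)

lemma AS_conv_span: "AS S = vec.span {glS_E (\<alpha> + \<beta>) (\<beta> - \<alpha>) | \<alpha> \<beta>. True}"
  by (simp add: AS_def glS_def lin_span_algebra_on_basis)

lemma AS_tau_simps [simp]:
  "carrier (AS_tau S) = {a \<in> AS S. glS_tau a = a}"
  "x \<otimes>\<^bsub>AS_tau S\<^esub> y = gl_bracket x y"
  "x \<oplus>\<^bsub>AS_tau S\<^esub> y = x + y"
  "\<zero>\<^bsub>AS_tau S\<^esub> = 0"
  "c \<odot>\<^bsub>AS_tau S\<^esub> x = scale_vec c x"
proof -
  have "x \<ominus>\<^bsub>glS S\<^esub> y = x - y" for x y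
    by (simp add: glS_def)
  then show "x \<otimes>\<^bsub>AS_tau S\<^esub> y = gl_bracket x y"
    by (simp add: AS_tau_def commutator_algebra_def gl_bracket_def gl_mult_def)
      (simp add: glS_def)
qed (simp_all add: AS_tau_def commutator_algebra_def glS_def algebra_on_basis_def)

lemma vec_linear_glS_tau: "vec_linear glS_tau"
  unfolding glS_tau_def by (rule vec_linear_linear_extension)

lemmas glS_tau_simps = vec_linearD[OF vec_linear_glS_tau]

lemma glS_tau_E [simp]: "glS_tau (glS_E \<alpha> \<beta>) = - glS_E \<beta> \<alpha>"
  by (simp add: glS_tau_def glS_E_def)

lemma subspace_AS_tau: "vec.subspace {a \<in> AS S. glS_tau a = a}"
  by (auto simp: vec.subspace_def AS_conv_span glS_tau_simps vec.span_add vec.span_scale vec.span_zero)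

section \<open>The homomorphism from \<open>\<gg>\<^sub>S\<close> to matrices\<close>

text \<open>With \<open>E = glS_E (\<alpha> + \<beta>) (\<beta> - \<alpha>)\<close> this is
  \<open>- (E + glS_tau E)\<close>, hence \<tau>-fixed. The opposite sign would turn the bracket
  relation into its negative.\<close>

definition d_matrix :: "'a::ab_group_add \<Rightarrow> 'a \<Rightarrow> 'a glS" where
  "d_matrix \<alpha> \<beta> = glS_E (\<beta> - \<alpha>) (\<alpha> + \<beta>) - glS_E (\<alpha> + \<beta>) (\<beta> - \<alpha>)"

lemma d_matrix_uminus: "d_matrix (- \<alpha>) \<beta> = - d_matrix \<alpha> \<beta>"
  by (simp add: d_matrix_def add.commute)

text \<open>The commutator expands into eight products of matrix units. Each of the four Kronecker
  terms accounts for two of them, one from either order of multiplication.\<close>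

lemma gl_bracket_d_matrix:
  "gl_bracket (d_matrix \<alpha> \<beta>) (d_matrix \<mu> \<nu>) =
     (d_matrix (\<alpha> + \<mu>) (- \<alpha> + \<nu>) when \<alpha> + \<mu> = \<nu> - \<beta>)
   - (d_matrix (\<alpha> + \<mu>) (\<alpha> + \<nu>) when \<alpha> + \<mu> = \<beta> - \<nu>)
   - (d_matrix (\<alpha> - \<mu>) (\<nu> - \<alpha>) when \<alpha> - \<mu> = \<nu> - \<beta>)
   + (d_matrix (\<alpha> - \<mu>) (\<alpha> + \<nu>) when \<alpha> - \<mu> = \<beta> - \<nu>)"
proof -
  let ?E = glS_E
  have 1: "(d_matrix (\<alpha> + \<mu>) (- \<alpha> + \<nu>) when \<alpha> + \<mu> = \<nu> - \<beta>)
      = (?E (\<beta> - \<alpha>) (\<mu> + \<nu>) when \<alpha> + \<beta> = \<nu> - \<mu>) - (?E (\<mu> + \<nu>) (\<beta> - \<alpha>) when \<nu> - \<mu> = \<alpha> + \<beta>)"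
    by (auto simp: when_def d_matrix_def algebra_simps)
  have 2: "(d_matrix (\<alpha> + \<mu>) (\<alpha> + \<nu>) when \<alpha> + \<mu> = \<beta> - \<nu>)
      = (?E (\<nu> - \<mu>) (\<alpha> + \<beta>) when \<mu> + \<nu> = \<beta> - \<alpha>) - (?E (\<alpha> + \<beta>) (\<nu> - \<mu>) when \<beta> - \<alpha> = \<mu> + \<nu>)"
    by (auto simp: when_def d_matrix_def algebra_simps)
  have 3: "(d_matrix (\<alpha> - \<mu>) (\<nu> - \<alpha>) when \<alpha> - \<mu> = \<nu> - \<beta>)
      = (?E (\<beta> - \<alpha>) (\<nu> - \<mu>) when \<alpha> + \<beta> = \<mu> + \<nu>) - (?E (\<nu> - \<mu>) (\<beta> - \<alpha>) when \<mu> + \<nu> = \<alpha> + \<beta>)"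
  proof (cases "\<alpha> + \<beta> = \<mu> + \<nu>")
    case True
    \<comment> \<open>The matrix indices on the two sides agree only under the condition, so it is
      solved for \<beta> and substituted.\<close>
    then have \<beta>: "\<beta> = \<mu> + \<nu> - \<alpha>" by (simp add: algebra_simps)
    show ?thesis unfolding \<beta> by (simp add: when_def d_matrix_def algebra_simps)
  next
    case False
    then show ?thesis by (auto simp: when_def algebra_simps)
  qed
  have 4: "(d_matrix (\<alpha> - \<mu>) (\<alpha> + \<nu>) when \<alpha> - \<mu> = \<beta> - \<nu>)
      = (?E (\<mu> + \<nu>) (\<alpha> + \<beta>) when \<nu> - \<mu> = \<beta> - \<alpha>) - (?E (\<alpha> + \<beta>) (\<mu> + \<nu>) when \<beta> - \<alpha> = \<nu> - \<mu>)"
    by (auto simp: when_def d_matrix_def algebra_simps)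
  show ?thesis
    unfolding 1 2 3 4 by (simp add: gl_bracket_def d_matrix_def gl_mult_linear gl_mult_E)
qed

definition gS_lift :: "'a::ab_group_add gS_free \<Rightarrow> 'a glS" where
  "gS_lift = free_lift (\<lambda>(\<alpha>, \<beta>). d_matrix \<alpha> \<beta>) gl_bracket"

lemma vec_linear_gS_lift: "vec_linear gS_lift"
  unfolding gS_lift_def by (rule vec_linear_free_lift)

lemmas gS_lift_simps = vec_linearD[OF vec_linear_gS_lift]

lemma gS_lift_gen [simp]: "gS_lift (free_gen (\<alpha>, \<beta>)) = d_matrix \<alpha> \<beta>"
  by (simp add: gS_lift_def)

lemma gS_lift_bracket: "gS_lift (free_bracket x y) = gl_bracket (gS_lift x) (gS_lift y)"
  unfolding gS_lift_def by (rule free_lift_bracket[OF vec_linear_gl_bracket])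

lemma gS_lift_relator:
  assumes "r \<in> gS_relators S"
  shows "gS_lift r = 0"
proof -
  have w: "gS_lift (x when P) = (gS_lift x when P)" for x P
    by (simp add: when_def gS_lift_simps)
  show ?thesis
    using assms unfolding gS_relators_def Let_def
    by (auto simp: gS_lift_simps w gS_lift_bracket gl_bracket_d_matrix d_matrix_uminus)
qed

lemma gS_lift_relation_ideal:
  assumes "x \<in> relation_ideal (gS_relators S)"
  shows "gS_lift x = 0"
  unfolding gS_lift_def
proof (rule relation_ideal_free_lift_zero[where b=gl_bracket and R="gS_relators S"])
  show "free_lift (\<lambda>(\<alpha>, \<beta>). d_matrix \<alpha> \<beta>) gl_bracket r = 0" if "r \<in> gS_relators S" for r
    using gS_lift_relator[OF that] by (simp only: gS_lift_def)
qed (fact vec_linear_gl_bracket gl_bracket_alternating gl_bracket_jacobi assms)+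

text \<open>The bracket relators rewrite a bracket of two generators, modulo the ideal, as a signed
  sum of four terms, each a generator or zero.\<close>

lemma gS_gen_span:
  "vec.span (relation_ideal (gS_relators S) \<union> range free_gen) = UNIV"
proof (rule relation_ideal_gen_span)
  fix x y :: "'a \<times> 'a"
  let ?T = "vec.span (relation_ideal (gS_relators S) \<union> range free_gen)"
  obtain \<alpha> \<beta> \<mu> \<nu> where xy: "x = (\<alpha>, \<beta>)" "y = (\<mu>, \<nu>)" by fastforce
  let ?d = "\<lambda>\<alpha> \<beta>. free_gen (\<alpha>, \<beta>)"
  let ?rhs = "(?d (\<alpha> + \<mu>) (- \<alpha> + \<nu>) when \<alpha> + \<mu> = \<nu> - \<beta>)
        - (?d (\<alpha> + \<mu>) (\<alpha> + \<nu>) when \<alpha> + \<mu> = \<beta> - \<nu>)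
        - (?d (\<alpha> - \<mu>) (\<nu> - \<alpha>) when \<alpha> - \<mu> = \<nu> - \<beta>)
        + (?d (\<alpha> - \<mu>) (\<alpha> + \<nu>) when \<alpha> - \<mu> = \<beta> - \<nu>)"
  have "free_bracket (?d \<alpha> \<beta>) (?d \<mu> \<nu>) - ?rhs \<in> gS_relators S"
    unfolding gS_relators_def Let_def by blast
  then have 1: "free_bracket (?d \<alpha> \<beta>) (?d \<mu> \<nu>) - ?rhs \<in> ?T"
    using relation_ideal_superset(2) by (blast intro: vec.span_base)
  have "(free_gen z when P) \<in> ?T" for z P
    by (simp add: when_def vec.span_base vec.span_zero)
  then have "?rhs \<in> ?T"
    by (intro vec.span_add vec.span_diff)
  with 1 have "free_bracket (?d \<alpha> \<beta>) (?d \<mu> \<nu>) - ?rhs + ?rhs \<in> ?T"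
    by (rule vec.span_add)
  then show "free_bracket (free_gen x) (free_gen y) \<in> ?T"
    by (simp add: xy)
qed

text \<open>The generators span modulo the relation ideal, which the lift kills, so only the
  matrices \<open>d_matrix \<alpha> \<beta>\<close> have to be checked and no brackets
  occur.\<close>

lemma gS_lift_in_AS_tau: "gS_lift x \<in> carrier (AS_tau S)"
proof -
  have E: "glS_E (\<alpha> + \<beta>) (\<beta> - \<alpha>) \<in> AS S" for \<alpha> \<beta> :: 'a
    unfolding AS_conv_span by (intro vec.span_base) blast
  have "d_matrix \<alpha> \<beta> \<in> {a \<in> AS S. glS_tau a = a}" for \<alpha> \<beta> :: 'a
    using E[of \<alpha> \<beta>] E[of "- \<alpha>" \<beta>]
    by (auto simp: d_matrix_def glS_tau_simps AS_conv_span add.commute intro: vec.span_diff)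
  then have gen: "gS_lift (free_gen u) \<in> {a \<in> AS S. glS_tau a = a}" for u
    by (cases u) simp
  have "x \<in> vec.span (relation_ideal (gS_relators S) \<union> range free_gen)"
    by (simp add: gS_gen_span)
  then have "gS_lift x \<in> {a \<in> AS S. glS_tau a = a}"
  proof (rule vec.span_induct)
    show "vec.subspace {x. gS_lift x \<in> {a \<in> AS S. glS_tau a = a}}"
      using subspace_AS_tau[of S] by (simp add: vec.subspace_def gS_lift_simps)
    show "gS_lift y \<in> {a \<in> AS S. glS_tau a = a}"
      if "y \<in> relation_ideal (gS_relators S) \<union> range free_gen" for y
      using that gen vec.subspace_0[OF subspace_AS_tau[of S]]
      by (auto simp: gS_lift_relation_ideal simp del: mem_Collect_eq)
  qed
  then show ?thesis by simp
qed

lemma gS_lift_hom: "alg_hom free_algebra (AS_tau S) gS_lift"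
  using gS_lift_in_AS_tau[of _ S]
  by (simp add: alg_hom_def gS_lift_simps gS_lift_bracket del: AS_tau_simps(1))

section \<open>A linear section of the lift, inverse to it modulo \<open>I\<close>\<close>

definition half_root :: "'a::ab_group_add \<Rightarrow> 'a \<Rightarrow> 'a" where
  "half_root p q = (SOME \<alpha>. \<alpha> + \<alpha> = p - q)"

text \<open>
  A linear section of \<^const>\<open>gS_lift\<close> over the \<open>\<tau>\<close>-fixed matrices.  The index pair \<open>(p, q)\<close>
  equals \<open>(\<alpha> + \<beta>, \<beta> - \<alpha>)\<close> iff \<open>2\<alpha> = p - q\<close> and \<open>\<beta> = p - \<alpha>\<close>; pairs admitting no such
  \<open>\<alpha>\<close> get an irrelevant value.
\<close>

definition gS_section :: "'a::ab_group_add glS \<Rightarrow> 'a gS_free" where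
  "gS_section = linear_extension
     (\<lambda>(p, q). scale_vec (- 1 / 2) (free_gen (half_root p q, p - half_root p q)))"

lemma vec_linear_gS_section: "vec_linear gS_section"
  unfolding gS_section_def by (rule vec_linear_linear_extension)

lemmas gS_section_simps = vec_linearD[OF vec_linear_gS_section]

text \<open>The chosen half root and \<alpha> have the same double, so they differ by some \<gamma>
  of order dividing two.\<close>

lemma gS_section_E:
  obtains \<gamma> where "\<gamma> + \<gamma> = 0"
    "gS_section (glS_E (\<alpha> + \<beta>) (\<beta> - \<alpha>)) = scale_vec (- 1 / 2) (free_gen (\<alpha> + \<gamma>, \<beta> + \<gamma>))"
proof
  let ?a = "half_root (\<alpha> + \<beta>) (\<beta> - \<alpha>)"
  have a: "?a + ?a = \<alpha> + \<beta> - (\<beta> - \<alpha>)"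
    unfolding half_root_def by (rule someI[of _ \<alpha>]) simp
  then show g: "(?a - \<alpha>) + (?a - \<alpha>) = 0"
    by (simp add: algebra_simps)
  \<comment> \<open>The second entry moves by minus this \<gamma>, which equals \<gamma>; thus both
    entries are shifted by the same element.\<close>
  then have b: "\<alpha> + \<beta> - ?a = \<beta> + (?a - \<alpha>)"
    by (simp add: algebra_simps)
  show "gS_section (glS_E (\<alpha> + \<beta>) (\<beta> - \<alpha>))
      = scale_vec (- 1 / 2) (free_gen (\<alpha> + (?a - \<alpha>), \<beta> + (?a - \<alpha>)))"
    unfolding b[symmetric] by (simp add: gS_section_def glS_E_def)
qed

lemma d_matrix_shift:
  assumes "\<gamma> + \<gamma> = 0"
  shows "d_matrix (\<alpha> + \<gamma>) (\<beta> + \<gamma>) = d_matrix \<alpha> \<beta>"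
proof -
  have "\<alpha> + \<gamma> + (\<beta> + \<gamma>) = \<alpha> + \<beta> + (\<gamma> + \<gamma>)"
    by (simp add: ac_simps)
  also have "\<dots> = \<alpha> + \<beta>"
    by (simp only: assms add_0_right)
  finally show ?thesis by (simp only: d_matrix_def) simp
qed

text \<open>The known spanning set is that of \<open>AS S\<close>, not of its \<tau>-fixed part.
  Hence span induction proves a formula on all of \<open>AS S\<close>: lift after section is the
  average of \<open>a\<close> and \<open>glS_tau a\<close>, which is \<open>a\<close> for fixed
  \<open>a\<close>.\<close>

lemma gS_lift_section:
  assumes "a \<in> carrier (AS_tau S)"
  shows "gS_lift (gS_section a) = a"
proof -
  have "a \<in> vec.span {glS_E (\<alpha> + \<beta>) (\<beta> - \<alpha>) | \<alpha> \<beta>. True}" and tau: "glS_tau a = a"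
    using assms by (simp_all add: AS_conv_span)
  from this(1) have "gS_lift (gS_section a) = scale_vec (1 / 2) (a + glS_tau a)"
  proof (rule vec.span_induct)
    show "vec.subspace {a. gS_lift (gS_section a) = scale_vec (1 / 2) (a + glS_tau a)}"
      by (auto simp: vec.subspace_def gS_lift_simps gS_section_simps glS_tau_simps
          vec.scale_right_distrib)
    fix x assume "x \<in> {glS_E (\<alpha> + \<beta>) (\<beta> - \<alpha>) | \<alpha> \<beta> :: 'a. True}"
    then obtain \<alpha> \<beta> :: 'a where x: "x = glS_E (\<alpha> + \<beta>) (\<beta> - \<alpha>)" by blast
    obtain \<gamma> where "\<gamma> + \<gamma> = 0"
      "gS_section x = scale_vec (- 1 / 2) (free_gen (\<alpha> + \<gamma>, \<beta> + \<gamma>))"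
      unfolding x by (rule gS_section_E)
    then show "gS_lift (gS_section x) = scale_vec (1 / 2) (x + glS_tau x)"
      by (simp add: gS_lift_simps d_matrix_shift x)
        (simp add: d_matrix_def vec.scale_right_diff_distrib flip: vec.scale_minus_left)
  qed
  also have "\<dots> = a"
    unfolding tau by (rule poly_mapping_eqI) (simp add: lookup_add)
  finally show ?thesis .
qed

text \<open>
  Since every element of \<open>\<gg>\<^sub>S\<close> is a linear combination of generators, it suffices to check the
  claim on generators, where the section returns the generator up to a shift by an element of
  order two.
\<close>

lemma section_lift_mod:
  assumes V: "vec.subspace V" and K: "relation_ideal (gS_relators S) \<subseteq> V"
    and shift: "\<And>\<alpha> \<beta> \<gamma>. \<gamma> + \<gamma> = 0 \<Longrightarrow> free_gen (\<alpha> + \<gamma>, \<beta> + \<gamma>) - free_gen (\<alpha>, \<beta>) \<in> V"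
  shows "x - gS_section (gS_lift x) \<in> V"
proof -
  note V_closed = vec.subspace_0[OF V] vec.subspace_add[OF V] vec.subspace_diff[OF V]
    vec.subspace_scale[OF V]
  \<comment> \<open>Modulo \<open>V\<close>, the section sends this matrix unit to
    \<open>- 1 / 2\<close> times the generator, whichever half root was chosen.\<close>
  have E: "gS_section (glS_E (\<alpha> + \<beta>) (\<beta> - \<alpha>)) + scale_vec (1 / 2) (free_gen (\<alpha>, \<beta>)) \<in> V"
    for \<alpha> \<beta> :: 'a
  proof -
    obtain \<gamma> where \<gamma>: "\<gamma> + \<gamma> = 0" and
      s: "gS_section (glS_E (\<alpha> + \<beta>) (\<beta> - \<alpha>)) = scale_vec (- 1 / 2) (free_gen (\<alpha> + \<gamma>, \<beta> + \<gamma>))"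
      by (rule gS_section_E)
    have "gS_section (glS_E (\<alpha> + \<beta>) (\<beta> - \<alpha>)) + scale_vec (1 / 2) (free_gen (\<alpha>, \<beta>))
        = scale_vec (- 1 / 2) (free_gen (\<alpha> + \<gamma>, \<beta> + \<gamma>) - free_gen (\<alpha>, \<beta>))"
      unfolding s by (rule poly_mapping_eqI) (simp add: lookup_add lookup_minus field_simps)
    also have "\<dots> \<in> V" by (intro V_closed shift \<gamma>)
    finally show ?thesis .
  qed
  have gen: "free_gen u - gS_section (gS_lift (free_gen u)) \<in> V" for u
  proof (cases u)
    case (Pair \<alpha> \<beta>)
    let ?d = "free_gen (\<alpha>, \<beta>)" and ?d' = "free_gen (- \<alpha>, \<beta>)"
    let ?s = "gS_section (glS_E (\<alpha> + \<beta>) (\<beta> - \<alpha>))" and ?s' = "gS_section (glS_E (\<beta> - \<alpha>) (\<alpha> + \<beta>))"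
    have "?d' - (- ?d) \<in> gS_relators S"
      unfolding gS_relators_def Let_def by blast
    then have "?d' + ?d \<in> V" using K relation_ideal_superset(2) by fastforce
    moreover have "?s' + scale_vec (1 / 2) ?d' \<in> V"
      using E[of "- \<alpha>" \<beta>] by (simp add: add.commute)
    \<comment> \<open>Modulo \<open>V\<close>, \<open>?s\<close> is minus half of \<open>?d\<close>,
      and \<open>?s'\<close> is minus half of \<open>?d'\<close>, that is plus half of
      \<open>?d\<close> by the sign relator. So \<open>?s' - ?s\<close>, the section of the lifted
      generator, is \<open>?d\<close>.\<close>
    ultimately have "(?s + scale_vec (1 / 2) ?d) - (?s' + scale_vec (1 / 2) ?d')
        + scale_vec (1 / 2) (?d' + ?d) \<in> V"
      by (intro vec.subspace_add[OF V vec.subspace_diff[OF V E] vec.subspace_scale[OF V]])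
    also have "(?s + scale_vec (1 / 2) ?d) - (?s' + scale_vec (1 / 2) ?d')
        + scale_vec (1 / 2) (?d' + ?d) = ?d - (?s' - ?s)"
      by (rule poly_mapping_eqI) (simp add: lookup_add lookup_minus field_simps)
    finally show ?thesis
      by (simp add: Pair d_matrix_def gS_section_simps)
  qed
  have "x \<in> vec.span (relation_ideal (gS_relators S) \<union> range free_gen)"
    by (simp add: gS_gen_span)
  then show ?thesis
  proof (rule vec.span_induct)
    have lin: "vec_linear (\<lambda>x. x - gS_section (gS_lift x))"
      by (rule vec_linearI) (simp_all add: gS_section_simps gS_lift_simps vec.scale_right_diff_distrib)
    show "vec.subspace {x. x - gS_section (gS_lift x) \<in> V}"
      unfolding vec.subspace_def using V_closed
      by (simp add: vec_linearD(1,2)[OF lin] gS_lift_simps(3) gS_section_simps(3))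
    show "y - gS_section (gS_lift y) \<in> V"
      if "y \<in> relation_ideal (gS_relators S) \<union> range free_gen" for y
      using that gen K by (auto simp: gS_lift_relation_ideal gS_section_simps)
  qed
qed

section \<open>Identification of \<open>I\<close> with the kernel, and the isomorphism\<close>

theorem proposition3p8:
  fixes S :: "'a::ab_group_add itself"
    and S0 :: "'a set"
    and I :: "'a gS_free set set"
  assumes S0_def: "S0 = {\<alpha>. \<alpha> + \<alpha> = 0}"
    and I_def: "I = lin_span (gS S)
      {gS_d (\<alpha> + \<gamma>) (\<beta> + \<gamma>) \<ominus>\<^bsub>gS S\<^esub> gS_d \<alpha> \<beta> | \<alpha> \<beta> \<gamma>. \<gamma> \<in> S0}"
  shows "lie_ideal I (gS S) \<and> lie_isomorphic (quotient_algebra (gS S) I) (AS_tau S)"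
proof -
  let ?coset = "presented_coset (gS_relators S)"
  let ?B = "{gS_d (\<alpha> + \<gamma>) (\<beta> + \<gamma>) \<ominus>\<^bsub>gS S\<^esub> gS_d \<alpha> \<beta> | \<alpha> \<beta> \<gamma>. \<gamma> \<in> S0}"
  have lie: "lie_algebra (gS S)"
    unfolding gS_def by (rule lie_algebra_presented)
  then interpret G: plain_complex_algebra "gS S"
    by (intro plain_complex_algebra.intro lie_algebra.axioms)
  have coset: "alg_hom free_algebra (gS S) ?coset"
    unfolding gS_def by (rule presented_coset_hom)
  have carrier: "carrier (gS S) = range ?coset"
    unfolding gS_def by (rule carrier_presented_lie_algebra)
  \<comment> \<open>\<open>gS_d\<close> refers to the token \<open>TYPE('a)\<close> and the coset
    map to \<open>S\<close>; unfolding the relators identifies the two.\<close>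
  have d: "gS_d \<alpha> \<beta> = ?coset (free_gen (\<alpha>, \<beta>))" for \<alpha> \<beta> :: 'a
    by (simp add: gS_d_def presented_gen_def gS_relators_def)
  have d_diff: "gS_d \<alpha> \<beta> \<ominus>\<^bsub>gS S\<^esub> gS_d \<mu> \<nu> = ?coset (free_gen (\<alpha>, \<beta>) - free_gen (\<mu>, \<nu>))"
    for \<alpha> \<beta> \<mu> \<nu> :: 'a
    using relation.hom_diff[OF coset G.complex_algebra_axioms] by (simp add: d)
  have "?B \<subseteq> carrier (gS S)"
    unfolding d_diff carrier by blast
  then have subI: "submodule I complex_ring (gS S)"
    unfolding I_def by (rule G.submodule_lin_span)
  note I_closed = G.submodule_closed[OF subI]
  note coset_simps = alg_homD[OF coset, simplified]
  \<comment> \<open>The section takes values in the free algebra, so \<open>I\<close> is pulled back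
    there to compare vectors instead of cosets.\<close>
  define V where "V = {x. ?coset x \<in> I}"
  have "vec.subspace V"
    unfolding V_def vec.subspace_def using I_closed by (simp add: coset_simps)
  moreover have "relation_ideal (gS_relators S) \<subseteq> V"
    unfolding V_def using I_closed(2) presented_coset_zero[of _ "gS_relators S"]
    by (auto simp: gS_def)
  moreover have "free_gen (\<alpha> + \<gamma>, \<beta> + \<gamma>) - free_gen (\<alpha>, \<beta>) \<in> V" if "\<gamma> + \<gamma> = 0" for \<alpha> \<beta> \<gamma>
  proof -
    have "gS_d (\<alpha> + \<gamma>) (\<beta> + \<gamma>) \<ominus>\<^bsub>gS S\<^esub> gS_d \<alpha> \<beta> \<in> I"
      unfolding I_def lin_span_def using that S0_def by (intro hull_inc) blast
    then show ?thesis by (simp add: V_def d_diff)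
  qed
  ultimately have diff_in_V: "x - gS_section (gS_lift x) \<in> V" for x
    by (rule section_lift_mod)
  obtain \<phi> where \<phi>: "alg_hom (gS S) (AS_tau S) \<phi>" and \<phi>_coset: "\<And>x. \<phi> (?coset x) = gS_lift x"
    using relation.quotient_lift[OF gS_lift_hom[of S], of "gS_relators S"] gS_lift_relation_ideal[of _ S]
    by (auto simp: gS_def presented_lie_algebra_def)
  have surj: "\<phi> ` carrier (gS S) = carrier (AS_tau S)"
  proof
    show "carrier (AS_tau S) \<subseteq> \<phi> ` carrier (gS S)"
      unfolding carrier image_image \<phi>_coset using gS_lift_section[of _ S]
      by (metis image_eqI subsetI UNIV_I)
  qed (use alg_homD(1)[OF \<phi>] in blast)
  \<comment> \<open>Kernels are ideals, so this equality shows that the linear span \<open>I\<close>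
    is an ideal without computing any bracket with its elements.\<close>
  have "I = {x \<in> carrier (gS S). \<phi> x = \<zero>\<^bsub>AS_tau S\<^esub>}" (is "_ = ?ker")
  proof
    have "?B \<subseteq> ?ker"
      unfolding d_diff carrier S0_def by (auto simp: \<phi>_coset gS_lift_simps d_matrix_shift)
    then show "I \<subseteq> ?ker"
      unfolding I_def lin_span_def
      using G.algebra_ideal_kernel[OF \<phi>] by (intro hull_minimal) (simp_all add: algebra_ideal_def)
    \<comment> \<open>If the lift of \<open>x\<close> is zero, so is its section, and
      \<open>diff_in_V\<close> says that \<open>x\<close> itself lies in \<open>V\<close>.\<close>
    show "?ker \<subseteq> I"
    proof
      fix C assume "C \<in> ?ker"
      then obtain x where "C = ?coset x" "gS_lift x = 0"
        by (auto simp: carrier \<phi>_coset)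
      then show "C \<in> I" using diff_in_V[of x] by (simp add: V_def gS_section_simps)
    qed
  qed
  then have ideal: "algebra_ideal I (gS S)" and iso: "lie_iso (quotient_algebra (gS S) I) (AS_tau S) \<noteq> {}"
    using G.algebra_ideal_kernel[OF \<phi>] G.quotient_kernel_iso[OF \<phi> surj] by simp_all
  interpret Q: ideal_of_algebra "gS S" I
    by (intro ideal_of_algebra.intro ideal_of_algebra_axioms.intro ideal G.plain_complex_algebra_axioms)
  \<comment> \<open>Both are images of \<open>gS S\<close>, under the coset map and under
    \<open>\<phi>\<close>.\<close>
  have "lie_algebra (quotient_algebra (gS S) I)" "lie_algebra (AS_tau S)"
    using lie_algebra.lie_algebra_hom_image[OF lie] Q.coset_hom Q.coset_surj \<phi> surj by blast+
  then show ?thesis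
    using lie ideal iso by (simp add: lie_ideal_def lie_isomorphic_def)
qed

end
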